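(* Let $\mathcal{A}$ be a category with coequalizers, let $(L,R,\eta,\epsilon)$ be an adjunction with $R:\mathcal{A}\to\mathcal{B}$, and let $n\in\mathbb{N}$. If the functor $L_{[n]}:\mathcal{B}_{[n]}\to\mathcal{A}$ of the adjoint decomposition of $(L,R)$ is fully faithful, then so is the functor $L_n:\mathcal{B}_n\to\mathcal{A}$ of the monadic tower of $(L,R)$, and $\Lambda_n:\mathcal{B}_n\to\mathcal{B}_{[n]}$ is a category isomorphism. In particular $R$ has a monadic decomposition of monadic length at most $n$.
   Context: Whiskering of a natural transformation by functors is written $F\alpha$, $\alpha G$. Coequalizers in $\mathcal{A}$ are fixed once and for all. Adjoint decomposition of $(L,R,\eta,\epsilon)$. Define recursively categories $\mathcal{B}_{[n]}$, functors $U_{[n]}:\mathcal{B}_{[n]}\to\mathcal{B}$, adjunctions $(L_{[n]},R_{[n]},\eta_{[n]},\epsilon_{[n]})$ with $R_{[n]}:\mathcal{A}\to\mathcal{B}_{[n]}$ and $U_{[n]}R_{[n]}=R$, and natural transformations $\pi_{[n]}:LU_{[n]}\to L_{[n]}$. For $n=0$: $\mathcal{B}_{[0]}=\mathcal{B}$, $U_{[0]}=\mathrm{Id}$, $(L_{[0]},R_{[0]},\eta_{[0]},\epsilon_{[0]})=(L,R,\eta,\epsilon)$, $\pi_{[0]}=\mathrm{Id}_L$. Given stage $n$: - objects of $\mathcal{B}_{[n+1]}$ are pairs $(B_{[n]},b_{[n]})$ with $B_{[n]}\in\mathcal{B}_{[n]}$ and $b_{[n]}:RL_{[n]}B_{[n]}\to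 U_{[n]}B_{[n]}$ any morphism in $\mathcal{B}$; morphisms $(B_{[n]},b_{[n]})\to(B'_{[n]},b'_{[n]})$ are morphisms $f:B_{[n]}\to B'_{[n]}$ in $\mathcal{B}_{[n]}$ with $U_{[n]}f\circ b_{[n]}=b'_{[n]}\circ RL_{[n]}f$; $U_{[n,n+1]}:\mathcal{B}_{[n+1]}\to\mathcal{B}_{[n]}$ is the forgetful functor and $U_{[n+1]}=U_{[n]}U_{[n,n+1]}$; - $R_{[n+1]}A=(R_{[n]}A,R\epsilon_{[n]}A)$, $R_{[n+1]}f=R_{[n]}f$; - $\pi_{[n,n+1]}B_{[n+1]}:L_{[n]}B_{[n]}\to L_{[n+1]}B_{[n+1]}$ is the coequalizer of $\pi_{[n]}B_{[n]}\circ Lb_{[n]}$ and $\epsilon L_{[n]}B_{[n]}$, both from $LRL_{[n]}B_{[n]}$ to $L_{[n]}B_{[n]}$, where $B_{[n+1]}=(B_{[n]},b_{[n]})$; $\pi_{[n+1]}=\pi_{[n,n+1]}\circ\pi_{[n]}U_{[n,n+1]}$; - the unit and counit of $(L_{[n+1]},R_{[n+1]})$ are determined by $U_{[n,n+1]}\eta_{[n+1]}=R_{[n]}\pi_{[n,n+1]}\circ\eta_{[n]}U_{[n,n+1]}$ and $\epsilon_{[n+1]}\circ\pi_{[n,n+1]}R_{[n+1]}=\epsilon_{[n]}$. Monadic tower of $(L,R)$. $\mathcal{B}_0=\mathcal{B}$, $(L_0,R_0,\eta_0,\epsilon_0)=(L,R,\eta,\epsilon)$. Given $(L_n,R_n,\eta_n,\epsilon_n)$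 with $R_n:\mathcal{A}\to\mathcal{B}_n$: $\mathcal{B}_{n+1}$ is the Eilenberg-Moore category of the monad $(R_nL_n,R_n\epsilon_nL_n,\eta_n)$ on $\mathcal{B}_n$, $U_{n,n+1}:\mathcal{B}_{n+1}\to\mathcal{B}_n$ is the forgetful functor, $R_{n+1}:\mathcal{A}\to\mathcal{B}_{n+1}$, $A\mapsto(R_nA,R_n\epsilon_nA)$, is the comparison functor, and $L_{n+1}$ is its left adjoint, with $L_{n+1}(B_n,\mu_n)$ the coequalizer of $L_n\mu_n,\epsilon_nL_nB_n:L_nR_nL_nB_n\to L_nB_n$; unit and counit $\eta_{n+1},\epsilon_{n+1}$. $U_n:\mathcal{B}_n\to\mathcal{B}$ is the composite of forgetful functors. $R$ has a monadic decomposition of monadic length $N$ if $L_N$ is fully faithful while $L_m$ is not fully faithful for $0\le m\le N-1$. The functors $\Lambda_n:\mathcal{B}_n\to\mathcal{B}_{[n]}$ are defined recursively, together with natural isomorphisms $\lambda_n:=\epsilon_{[n]}L_n\circ L_{[n]}\Lambda_n\eta_n:L_{[n]}\Lambda_n\to L_n$ (one has $\Lambda_nR_n=R_{[n]}$): $\Lambda_0=\mathrm{Id}$, and $\Lambda_{n+1}(V_n,\mu_n)=(\Lambda_nV_n,\;U_n\mu_n\circ R\lambda_nV_n)$, $U_{[n,n+1]}\Lambda_{n+1}f=\Lambda_nU_{n,n+1}f$. Each $\Lambda_n$ is fully faithful and injective on objects. *)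

theory Defs
  imports Main
begin

section \<open>Categories, functors, adjunctions\<close>

text \<open>
  A category is given by its objects, a family of hom-sets, identities and a composition.
  Hom-sets are not required to be disjoint; hence the action of a functor on an arrow
  takes the source and the target of that arrow as additional arguments.  The axioms constrain
  the data on objects and hom-sets only.  Categories with disjoint hom-sets (source and target
  determined by the arrow) are a special case.
\<close>

record ('o, 'm) category_data =
  Obj :: "'o set"
  Hom :: "'o \<Rightarrow> 'o \<Rightarrow> 'm set"
  Ident :: "'o \<Rightarrow> 'm"
  Cmp :: "'m \<Rightarrow> 'm \<Rightarrow> 'm" (infixl "\<cdot>\<index>" 70)

locale category =
  fixes C :: "('o, 'm) category_data"
  assumes ident_in_hom: "X \<in> Obj C \<Longrightarrow> Ident C X \<in> Hom C X X"
    and cmp_in_hom: "\<lbrakk>X \<in> Obj C; Y \<in> Obj C; Z \<in> Obj C; f \<in> Hom C X Y; g \<in> Hom C Y Z\<rbrakk>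
      \<Longrightarrow> g \<cdot>\<^bsub>C\<^esub> f \<in> Hom C X Z"
    and cmp_ident_left: "\<lbrakk>X \<in> Obj C; Y \<in> Obj C; f \<in> Hom C X Y\<rbrakk> \<Longrightarrow> Ident C Y \<cdot>\<^bsub>C\<^esub> f = f"
    and cmp_ident_right: "\<lbrakk>X \<in> Obj C; Y \<in> Obj C; f \<in> Hom C X Y\<rbrakk> \<Longrightarrow> f \<cdot>\<^bsub>C\<^esub> Ident C X = f"
    and cmp_assoc: "\<lbrakk>W \<in> Obj C; X \<in> Obj C; Y \<in> Obj C; Z \<in> Obj C;
        f \<in> Hom C W X; g \<in> Hom C X Y; h \<in> Hom C Y Z\<rbrakk>
      \<Longrightarrow> (h \<cdot>\<^bsub>C\<^esub> g) \<cdot>\<^bsub>C\<^esub> f = h \<cdot>\<^bsub>C\<^esub> (g \<cdot>\<^bsub>C\<^esub> f)"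

record ('o, 'm, 'p, 'n) functor_data =
  FObj :: "'o \<Rightarrow> 'p"
  FMap :: "'o \<Rightarrow> 'o \<Rightarrow> 'm \<Rightarrow> 'n"

locale cat_functor = C: category C + D: category D
  for C :: "('o, 'm) category_data" and D :: "('p, 'n) category_data" +
  fixes F :: "('o, 'm, 'p, 'n) functor_data"
  assumes fobj_in_obj: "X \<in> Obj C \<Longrightarrow> FObj F X \<in> Obj D"
    and fmap_in_hom: "\<lbrakk>X \<in> Obj C; Y \<in> Obj C; f \<in> Hom C X Y\<rbrakk>
      \<Longrightarrow> FMap F X Y f \<in> Hom D (FObj F X) (FObj F Y)"
    and fmap_ident: "X \<in> Obj C \<Longrightarrow> FMap F X X (Ident C X) = Ident D (FObj F X)"
    and fmap_cmp: "\<lbrakk>X \<in> Obj C; Y \<in> Obj C; Z \<in> Obj C; f \<in> Hom C X Y; g \<in> Hom C Y Z\<rbrakk>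
      \<Longrightarrow> FMap F X Z (g \<cdot>\<^bsub>C\<^esub> f) = FMap F Y Z g \<cdot>\<^bsub>D\<^esub> FMap F X Y f"

definition id_functor :: "('o, 'm, 'o, 'm) functor_data" where
  "id_functor = \<lparr>FObj = (\<lambda>X. X), FMap = (\<lambda>X Y f. f)\<rparr>"

definition comp_functor ::
    "('p, 'n, 'q, 'k) functor_data \<Rightarrow> ('o, 'm, 'p, 'n) functor_data \<Rightarrow> ('o, 'm, 'q, 'k) functor_data"
    (infixl "\<circ>\<^sub>F" 65) where
  "G \<circ>\<^sub>F F = \<lparr>FObj = (\<lambda>X. FObj G (FObj F X)),
    FMap = (\<lambda>X Y f. FMap G (FObj F X) (FObj F Y) (FMap F X Y f))\<rparr>"

locale fully_faithful = cat_functor C D F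
  for C :: "('o, 'm) category_data" and D :: "('p, 'n) category_data"
    and F :: "('o, 'm, 'p, 'n) functor_data" +
  assumes fmap_bij: "\<lbrakk>X \<in> Obj C; Y \<in> Obj C\<rbrakk>
    \<Longrightarrow> bij_betw (FMap F X Y) (Hom C X Y) (Hom D (FObj F X) (FObj F Y))"

definition functor_eq_on ::
    "('o, 'm) category_data \<Rightarrow> ('o, 'm, 'p, 'n) functor_data \<Rightarrow> ('o, 'm, 'p, 'n) functor_data \<Rightarrow> bool"
  where
  "functor_eq_on C F G \<longleftrightarrow>
    (\<forall>X \<in> Obj C. FObj F X = FObj G X) \<and>
    (\<forall>X \<in> Obj C. \<forall>Y \<in> Obj C. \<forall>f \<in> Hom C X Y. FMap F X Y f = FMap G X Y f)"

definition category_isomorphism ::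
    "('o, 'm) category_data \<Rightarrow> ('p, 'n) category_data \<Rightarrow> ('o, 'm, 'p, 'n) functor_data \<Rightarrow> bool" where
  "category_isomorphism C D F \<longleftrightarrow> cat_functor C D F \<and>
    (\<exists>G. cat_functor D C G \<and>
      functor_eq_on C (G \<circ>\<^sub>F F) id_functor \<and> functor_eq_on D (F \<circ>\<^sub>F G) id_functor)"

locale nat_trans = F: cat_functor C D F + G: cat_functor C D G
  for C :: "('o, 'm) category_data" and D :: "('p, 'n) category_data"
    and F :: "('o, 'm, 'p, 'n) functor_data" and G :: "('o, 'm, 'p, 'n) functor_data" +
  fixes \<alpha> :: "'o \<Rightarrow> 'n"
  assumes component_in_hom: "X \<in> Obj C \<Longrightarrow> \<alpha> X \<in> Hom D (FObj F X) (FObj G X)"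
    and naturality: "\<lbrakk>X \<in> Obj C; Y \<in> Obj C; f \<in> Hom C X Y\<rbrakk>
      \<Longrightarrow> FMap G X Y f \<cdot>\<^bsub>D\<^esub> \<alpha> X = \<alpha> Y \<cdot>\<^bsub>D\<^esub> FMap F X Y f"

text \<open>The adjunction \<open>(L, R, \<eta>, \<epsilon>)\<close> with \<open>R : A \<rightarrow> B\<close> right adjoint to \<open>L : B \<rightarrow> A\<close>.\<close>

locale adjunction =
  L: cat_functor B A L + R: cat_functor A B R +
  unit: nat_trans B B id_functor "R \<circ>\<^sub>F L" \<eta> +
  counit: nat_trans A A "L \<circ>\<^sub>F R" id_functor \<epsilon>
  for A :: "('p, 'n) category_data" and B :: "('o, 'm) category_data"
    and L :: "('o, 'm, 'p, 'n) functor_data" and R :: "('p, 'n, 'o, 'm) functor_data"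
    and \<eta> :: "'o \<Rightarrow> 'm" and \<epsilon> :: "'p \<Rightarrow> 'n" +
  assumes triangle_left: "X \<in> Obj B \<Longrightarrow>
      \<epsilon> (FObj L X) \<cdot>\<^bsub>A\<^esub> FMap L X (FObj R (FObj L X)) (\<eta> X) = Ident A (FObj L X)"
    and triangle_right: "Y \<in> Obj A \<Longrightarrow>
      FMap R (FObj L (FObj R Y)) Y (\<epsilon> Y) \<cdot>\<^bsub>B\<^esub> \<eta> (FObj R Y) = Ident B (FObj R Y)"

definition is_coequalizer ::
    "('p, 'n) category_data \<Rightarrow> 'p \<Rightarrow> 'p \<Rightarrow> 'n \<Rightarrow> 'n \<Rightarrow> 'p \<Rightarrow> 'n \<Rightarrow> bool" where
  "is_coequalizer A X Y f g Q q \<longleftrightarrow>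
    Q \<in> Obj A \<and> q \<in> Hom A Y Q \<and> q \<cdot>\<^bsub>A\<^esub> f = q \<cdot>\<^bsub>A\<^esub> g \<and>
    (\<forall>Z \<in> Obj A. \<forall>h \<in> Hom A Y Z. h \<cdot>\<^bsub>A\<^esub> f = h \<cdot>\<^bsub>A\<^esub> g \<longrightarrow>
      (\<exists>!k. k \<in> Hom A Q Z \<and> k \<cdot>\<^bsub>A\<^esub> q = h))"

text \<open>\<open>cq X Y f g\<close> is the fixed coequalizer (object and arrow) of \<open>f, g : X \<rightarrow> Y\<close>.\<close>

type_synonym ('p, 'n) coeq_choice = "'p \<Rightarrow> 'p \<Rightarrow> 'n \<Rightarrow> 'n \<Rightarrow> 'p \<times> 'n"

definition chosen_coequalizers :: "('p, 'n) category_data \<Rightarrow> ('p, 'n) coeq_choice \<Rightarrow> bool" where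
  "chosen_coequalizers A cq \<longleftrightarrow>
    (\<forall>X \<in> Obj A. \<forall>Y \<in> Obj A. \<forall>f \<in> Hom A X Y. \<forall>g \<in> Hom A X Y.
      is_coequalizer A X Y f g (fst (cq X Y f g)) (snd (cq X Y f g)))"


section \<open>Stages of a tower\<close>

text \<open>
  An object of the \<open>n\<close>-th category of either tower is an \<open>n\<close>-fold nested pair over an object of \<open>B\<close>;
  \<open>Ext V b\<close> stands for the pair \<open>(V, b)\<close> and \<open>Base\<close> only tags the objects of \<open>B\<close>, which makes
  all stages have the same type.  A morphism at stage \<open>n + 1\<close> is a morphism at stage \<open>n\<close>, so it
  is literally an arrow of \<open>B\<close>: every forgetful functor is the identity on arrows.  On objects,
  \<open>under\<close> is the one-step forgetful functor and \<open>base\<close> the composite of all of them.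
\<close>

datatype ('o, 'm) tower_obj =
  Base 'o
| Ext (under: "('o, 'm) tower_obj") (str: 'm)

primrec base :: "('o, 'm) tower_obj \<Rightarrow> 'o" where
  "base (Base X) = X"
| "base (Ext V b) = base V"

text \<open>
  A stage: a category \<open>Cat\<close> over \<open>B\<close>, an adjunction \<open>(Lft, Rgt, Unit, Counit)\<close> with
  \<open>Rgt : A \<rightarrow> Cat\<close>, and the components \<open>Proj V : L (base V) \<rightarrow> Lft V\<close> of the transformation
  called \<open>\<pi>\<close> in the adjoint decomposition (it plays no role in the monadic tower).
\<close>

record ('o, 'm, 'p, 'n) stage =
  Cat :: "(('o, 'm) tower_obj, 'm) category_data"
  Lft :: "(('o, 'm) tower_obj, 'm, 'p, 'n) functor_data"
  Rgt :: "('p, 'n, ('o, 'm) tower_obj, 'm) functor_data"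
  Unit :: "('o, 'm) tower_obj \<Rightarrow> 'm"
  Counit :: "'p \<Rightarrow> 'n"
  Proj :: "('o, 'm) tower_obj \<Rightarrow> 'n"

definition initial_stage ::
    "('p, 'n) category_data \<Rightarrow> ('o, 'm) category_data \<Rightarrow> ('o, 'm, 'p, 'n) functor_data \<Rightarrow>
     ('p, 'n, 'o, 'm) functor_data \<Rightarrow> ('o \<Rightarrow> 'm) \<Rightarrow> ('p \<Rightarrow> 'n) \<Rightarrow> ('o, 'm, 'p, 'n) stage" where
  "initial_stage A B L R \<eta> \<epsilon> =
    \<lparr>Cat = \<lparr>Obj = Base ` Obj B, Hom = (\<lambda>V W. Hom B (base V) (base W)),
            Ident = (\<lambda>V. Ident B (base V)), Cmp = Cmp B\<rparr>,
     Lft = \<lparr>FObj = (\<lambda>V. FObj L (base V)), FMap = (\<lambda>V W f. FMap L (base V) (base W) f)\<rparr>,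
     Rgt = \<lparr>FObj = (\<lambda>Y. Base (FObj R Y)), FMap = FMap R\<rparr>,
     Unit = (\<lambda>V. \<eta> (base V)),
     Counit = \<epsilon>,
     Proj = (\<lambda>V. Ident A (FObj L (base V)))\<rparr>"

text \<open>
  The part of the recursion common to both towers: from a stage \<open>S\<close>, the next category \<open>C'\<close>, the
  structure arrow \<open>r Y\<close> of the next right adjoint at \<open>Y\<close>, and the coequalizer
  \<open>c X = (L' X, p X)\<close> with \<open>p X : Lft S (under X) \<rightarrow> L' X\<close>.  The next left adjoint acts on
  arrows in the only way that makes \<open>p\<close> natural; unit and counit are determined by
  \<open>U \<eta>' = R p \<circ> \<eta> U\<close> and \<open>\<epsilon>' \<circ> p R' = \<epsilon>\<close>.
\<close>

definition next_stage ::
    "('p, 'n) category_data \<Rightarrow> ('o, 'm, 'p, 'n) stage \<Rightarrow>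
     (('o, 'm) tower_obj, 'm) category_data \<Rightarrow> ('p \<Rightarrow> 'm) \<Rightarrow>
     (('o, 'm) tower_obj \<Rightarrow> 'p \<times> 'n) \<Rightarrow> ('o, 'm, 'p, 'n) stage" where
  "next_stage A S C' r c = (let
      L' = (\<lambda>X. fst (c X));
      p = (\<lambda>X. snd (c X));
      R' = (\<lambda>Y. Ext (FObj (Rgt S) Y) (r Y))
    in
    \<lparr>Cat = C',
     Lft = \<lparr>FObj = L',
       FMap = (\<lambda>X Y f. THE k. k \<in> Hom A (L' X) (L' Y) \<and>
         k \<cdot>\<^bsub>A\<^esub> p X = p Y \<cdot>\<^bsub>A\<^esub> FMap (Lft S) (under X) (under Y) f)\<rparr>,
     Rgt = \<lparr>FObj = R', FMap = FMap (Rgt S)\<rparr>,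
     Unit = (\<lambda>X. FMap (Rgt S) (FObj (Lft S) (under X)) (L' X) (p X) \<cdot>\<^bsub>Cat S\<^esub> Unit S (under X)),
     Counit = (\<lambda>Y. THE e. e \<in> Hom A (L' (R' Y)) Y \<and> e \<cdot>\<^bsub>A\<^esub> p (R' Y) = Counit S Y),
     Proj = (\<lambda>X. p X \<cdot>\<^bsub>A\<^esub> Proj S (under X))\<rparr>)"


section \<open>The adjoint decomposition\<close>

definition adj_category ::
    "('o, 'm) category_data \<Rightarrow> ('p, 'n, 'o, 'm) functor_data \<Rightarrow> ('o, 'm, 'p, 'n) stage \<Rightarrow>
     (('o, 'm) tower_obj, 'm) category_data" where
  "adj_category B R S =
    \<lparr>Obj = {Ext V b |V b. V \<in> Obj (Cat S) \<and> b \<in> Hom B (FObj R (FObj (Lft S) V)) (base V)},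
     Hom = (\<lambda>X Y. {f \<in> Hom (Cat S) (under X) (under Y).
       f \<cdot>\<^bsub>B\<^esub> str X = str Y \<cdot>\<^bsub>B\<^esub> FMap (R \<circ>\<^sub>F Lft S) (under X) (under Y) f}),
     Ident = (\<lambda>X. Ident (Cat S) (under X)),
     Cmp = Cmp (Cat S)\<rparr>"

text \<open>The coequalizer of \<open>\<pi> V \<circ> L b\<close> and \<open>\<epsilon> (Lft V)\<close>, both from \<open>L (R (Lft V))\<close> to \<open>Lft V\<close>.\<close>

definition adj_coeq ::
    "('p, 'n) category_data \<Rightarrow> ('p, 'n) coeq_choice \<Rightarrow> ('o, 'm, 'p, 'n) functor_data \<Rightarrow>
     ('p, 'n, 'o, 'm) functor_data \<Rightarrow> ('p \<Rightarrow> 'n) \<Rightarrow> ('o, 'm, 'p, 'n) stage \<Rightarrow>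
     ('o, 'm) tower_obj \<Rightarrow> 'p \<times> 'n" where
  "adj_coeq A cq L R \<epsilon> S X = (let V = under X; b = str X; M = FObj (Lft S) V in
    cq (FObj L (FObj R M)) M
      (Proj S V \<cdot>\<^bsub>A\<^esub> FMap L (FObj R M) (base V) b)
      (\<epsilon> M))"

primrec adj_decomposition ::
    "('p, 'n) category_data \<Rightarrow> ('p, 'n) coeq_choice \<Rightarrow> ('o, 'm) category_data \<Rightarrow>
     ('o, 'm, 'p, 'n) functor_data \<Rightarrow> ('p, 'n, 'o, 'm) functor_data \<Rightarrow> ('o \<Rightarrow> 'm) \<Rightarrow> ('p \<Rightarrow> 'n) \<Rightarrow>
     nat \<Rightarrow> ('o, 'm, 'p, 'n) stage" where
  "adj_decomposition A cq B L R \<eta> \<epsilon> 0 = initial_stage A B L R \<eta> \<epsilon>"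
| "adj_decomposition A cq B L R \<eta> \<epsilon> (Suc n) = (let S = adj_decomposition A cq B L R \<eta> \<epsilon> n in
    next_stage A S (adj_category B R S)
      (\<lambda>Y. FMap R (FObj (Lft S) (FObj (Rgt S) Y)) Y (Counit S Y))
      (adj_coeq A cq L R \<epsilon> S))"


section \<open>The monadic tower\<close>

definition is_algebra ::
    "('x, 'm) category_data \<Rightarrow> ('x, 'm, 'x, 'm) functor_data \<Rightarrow> ('x \<Rightarrow> 'm) \<Rightarrow> ('x \<Rightarrow> 'm) \<Rightarrow>
     'x \<Rightarrow> 'm \<Rightarrow> bool" where
  "is_algebra C T m u V \<mu> \<longleftrightarrow> V \<in> Obj C \<and> \<mu> \<in> Hom C (FObj T V) V \<and>
    \<mu> \<cdot>\<^bsub>C\<^esub> u V = Ident C V \<and> \<mu> \<cdot>\<^bsub>C\<^esub> FMap T (FObj T V) V \<mu> = \<mu> \<cdot>\<^bsub>C\<^esub> m V"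

definition eilenberg_moore ::
    "(('o, 'm) tower_obj, 'm) category_data \<Rightarrow>
     (('o, 'm) tower_obj, 'm, ('o, 'm) tower_obj, 'm) functor_data \<Rightarrow>
     (('o, 'm) tower_obj \<Rightarrow> 'm) \<Rightarrow> (('o, 'm) tower_obj \<Rightarrow> 'm) \<Rightarrow>
     (('o, 'm) tower_obj, 'm) category_data" where
  "eilenberg_moore C T m u =
    \<lparr>Obj = {Ext V \<mu> |V \<mu>. is_algebra C T m u V \<mu>},
     Hom = (\<lambda>X Y. {f \<in> Hom C (under X) (under Y).
       f \<cdot>\<^bsub>C\<^esub> str X = str Y \<cdot>\<^bsub>C\<^esub> FMap T (under X) (under Y) f}),
     Ident = (\<lambda>X. Ident C (under X)),
     Cmp = Cmp C\<rparr>"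

text \<open>The Eilenberg-Moore category of the monad \<open>(R\<^sub>n L\<^sub>n, R\<^sub>n \<epsilon>\<^sub>n L\<^sub>n, \<eta>\<^sub>n)\<close>.\<close>

definition monadic_category ::
    "('o, 'm, 'p, 'n) stage \<Rightarrow> (('o, 'm) tower_obj, 'm) category_data" where
  "monadic_category S = eilenberg_moore (Cat S) (Rgt S \<circ>\<^sub>F Lft S)
    (\<lambda>V. FMap (Rgt S) (FObj (Lft S \<circ>\<^sub>F Rgt S) (FObj (Lft S) V)) (FObj (Lft S) V)
      (Counit S (FObj (Lft S) V)))
    (Unit S)"

text \<open>The coequalizer of \<open>L\<^sub>n \<mu>\<close> and \<open>\<epsilon>\<^sub>n (L\<^sub>n V)\<close>.\<close>

definition monadic_coeq ::
    "('p, 'n) coeq_choice \<Rightarrow> ('o, 'm, 'p, 'n) stage \<Rightarrow> ('o, 'm) tower_obj \<Rightarrow> 'p \<times> 'n" where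
  "monadic_coeq cq S X = (let V = under X; \<mu> = str X; M = FObj (Lft S) V in
    cq (FObj (Lft S) (FObj (Rgt S) M)) M
      (FMap (Lft S) (FObj (Rgt S) M) V \<mu>)
      (Counit S M))"

primrec monadic_tower ::
    "('p, 'n) category_data \<Rightarrow> ('p, 'n) coeq_choice \<Rightarrow> ('o, 'm) category_data \<Rightarrow>
     ('o, 'm, 'p, 'n) functor_data \<Rightarrow> ('p, 'n, 'o, 'm) functor_data \<Rightarrow> ('o \<Rightarrow> 'm) \<Rightarrow> ('p \<Rightarrow> 'n) \<Rightarrow>
     nat \<Rightarrow> ('o, 'm, 'p, 'n) stage" where
  "monadic_tower A cq B L R \<eta> \<epsilon> 0 = initial_stage A B L R \<eta> \<epsilon>"
| "monadic_tower A cq B L R \<eta> \<epsilon> (Suc n) = (let S = monadic_tower A cq B L R \<eta> \<epsilon> n in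
    next_stage A S (monadic_category S)
      (\<lambda>Y. FMap (Rgt S) (FObj (Lft S) (FObj (Rgt S) Y)) Y (Counit S Y))
      (monadic_coeq cq S))"

definition has_monadic_decomposition_of_length ::
    "('p, 'n) category_data \<Rightarrow> ('p, 'n) coeq_choice \<Rightarrow> ('o, 'm) category_data \<Rightarrow>
     ('o, 'm, 'p, 'n) functor_data \<Rightarrow> ('p, 'n, 'o, 'm) functor_data \<Rightarrow> ('o \<Rightarrow> 'm) \<Rightarrow> ('p \<Rightarrow> 'n) \<Rightarrow>
     nat \<Rightarrow> bool" where
  "has_monadic_decomposition_of_length A cq B L R \<eta> \<epsilon> N \<longleftrightarrow>
    (let T = monadic_tower A cq B L R \<eta> \<epsilon> in
      fully_faithful (Cat (T N)) A (Lft (T N)) \<and>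
      (\<forall>m<N. \<not> fully_faithful (Cat (T m)) A (Lft (T m))))"


section \<open>The comparison of the two towers\<close>

text \<open>
  For stages \<open>T\<close> (monadic) and \<open>S\<close> (adjoint) and \<open>\<Lambda> : Cat T \<rightarrow> Cat S\<close>, the component at \<open>V\<close> of
  \<open>\<epsilon>\<^sub>[\<^sub>n\<^sub>] L\<^sub>n \<circ> L\<^sub>[\<^sub>n\<^sub>] \<Lambda> \<eta>\<^sub>n : L\<^sub>[\<^sub>n\<^sub>] \<Lambda> \<rightarrow> L\<^sub>n\<close>.
\<close>

definition comparison_iso ::
    "('p, 'n) category_data \<Rightarrow> ('o, 'm, 'p, 'n) stage \<Rightarrow> ('o, 'm, 'p, 'n) stage \<Rightarrow>
     (('o, 'm) tower_obj, 'm, ('o, 'm) tower_obj, 'm) functor_data \<Rightarrow> ('o, 'm) tower_obj \<Rightarrow> 'n" where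
  "comparison_iso A T S \<Lambda> V =
    Counit S (FObj (Lft T) V) \<cdot>\<^bsub>A\<^esub> FMap (Lft S \<circ>\<^sub>F \<Lambda>) V (FObj (Rgt T \<circ>\<^sub>F Lft T) V) (Unit T V)"

primrec comparison ::
    "('p, 'n) category_data \<Rightarrow> ('p, 'n) coeq_choice \<Rightarrow> ('o, 'm) category_data \<Rightarrow>
     ('o, 'm, 'p, 'n) functor_data \<Rightarrow> ('p, 'n, 'o, 'm) functor_data \<Rightarrow> ('o \<Rightarrow> 'm) \<Rightarrow> ('p \<Rightarrow> 'n) \<Rightarrow>
     nat \<Rightarrow> (('o, 'm) tower_obj, 'm, ('o, 'm) tower_obj, 'm) functor_data" where
  "comparison A cq B L R \<eta> \<epsilon> 0 = id_functor"
| "comparison A cq B L R \<eta> \<epsilon> (Suc n) = (let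
      T = monadic_tower A cq B L R \<eta> \<epsilon> n;
      S = adj_decomposition A cq B L R \<eta> \<epsilon> n;
      \<Lambda> = comparison A cq B L R \<eta> \<epsilon> n
    in
    \<lparr>FObj = (\<lambda>X. let V = under X; \<mu> = str X in
       Ext (FObj \<Lambda> V)
         (\<mu> \<cdot>\<^bsub>B\<^esub> FMap R (FObj (Lft S) (FObj \<Lambda> V)) (FObj (Lft T) V) (comparison_iso A T S \<Lambda> V))),
     FMap = (\<lambda>X Y f. FMap \<Lambda> (under X) (under Y) f)\<rparr>)"

end

theory Submission
  imports Defs
begin

text \<open>
  Write \<open>T\<close> and \<open>S\<close> for the \<open>n\<close>-th stages of the monadic tower and of the adjoint decomposition,
  \<open>\<Lambda>\<close> for the comparison functor between their categories, and \<open>\<eta>\<^sub>S\<close>, \<open>\<eta>\<^sub>T\<close> for the units.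

  If \<open>Lft S\<close> is fully faithful, then \<open>\<eta>\<^sub>S\<close> is invertible, so every object \<open>X\<close> of \<open>Cat S\<close> is
  isomorphic to \<open>Rgt S (Lft S X) = \<Lambda> (Rgt T (Lft S X))\<close>; thus \<open>\<Lambda>\<close> is essentially surjective.  What
  turns this into an isomorphism of categories is that the image of \<open>\<Lambda>\<close> is closed under
  isomorphism (a replete subcategory): an algebra structure can be transported along an
  isomorphism, and the structure arrow of an object of \<open>Cat S\<close> that is isomorphic to an object of the image is
  forced to be the one that comes from the transported algebra.  Since \<open>\<Lambda>\<close> is also full, faithful
  and injective on objects, it is then bijective on objects and on arrows.  As \<open>Lft S \<circ> \<Lambda>\<close> is naturally
  isomorphic to \<open>Lft T\<close>, full faithfulness passes to \<open>Lft T\<close>, and the least stage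
  at which the left adjoint is fully faithful is the monadic length.

  The rest is the verification, by one induction on \<open>n\<close>, that the recursions produce what they
  should.  It rests on three observations.

  First, both towers take the same step.  The Eilenberg-Moore category over a stage is a full
  subcategory of the category of all pairs \<open>(V, b)\<close> over that stage, because its arrows satisfy the same
  equation, read in \<open>B\<close>; and for both coequalizers, an arrow \<open>h : Lft S V \<rightarrow> Y\<close> factors through them
  exactly if the arrow \<open>V \<rightarrow> Rgt S Y\<close> that corresponds to \<open>h\<close> is compatible with the structure arrows.
  The locale \<open>next_tower_stage\<close> isolates this situation, and
  \<open>tower_stage_next\<close> shows that the next stage is again an adjunction with all the required
  compatibilities.

  Second, by \<open>adjunction_from_universal_arrows\<close> an adjunction may be checked on its
  unit alone, which is what makes the coequalizer construction easy to control.

  Third, the transformation \<open>\<lambda> : Lft S \<circ> \<Lambda> \<rightarrow> Lft T\<close> is invertible for formal reasons: \<open>\<Lambda>\<close> is fully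
  faithful and \<open>\<Lambda> \<circ> Rgt T = Rgt S\<close>, so \<open>Lft S (\<Lambda> V)\<close> and \<open>Lft T V\<close> represent the same functor.  The locale
  \<open>comparison_stage\<close> collects what is carried through the induction, and
  \<open>next_comparison_stage\<close> is the induction step.
\<close>

section \<open>Arrows, functors and adjunctions\<close>

text \<open>
  The laws of a category assume that sources and targets are objects.  Putting this into the
  membership of an arrow in \<open>X \<rightarrow>\<^bsub>C\<^esub> Y\<close> makes the laws compose without further side conditions.
\<close>

definition arrows :: "('o, 'm) category_data \<Rightarrow> 'o \<Rightarrow> 'o \<Rightarrow> 'm set" (infix "\<rightarrow>\<index>" 60) where
  "X \<rightarrow>\<^bsub>C\<^esub> Y = {f \<in> Hom C X Y. X \<in> Obj C \<and> Y \<in> Obj C}"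

lemma arrows_iff: "f \<in> X \<rightarrow>\<^bsub>C\<^esub> Y \<longleftrightarrow> X \<in> Obj C \<and> Y \<in> Obj C \<and> f \<in> Hom C X Y"
  by (auto simp: arrows_def)

lemma arrows_dom: "f \<in> X \<rightarrow>\<^bsub>C\<^esub> Y \<Longrightarrow> X \<in> Obj C"
  and arrows_cod: "f \<in> X \<rightarrow>\<^bsub>C\<^esub> Y \<Longrightarrow> Y \<in> Obj C"
  by (auto simp: arrows_def)

context category
begin

lemma ident_arrow: "X \<in> Obj C \<Longrightarrow> Ident C X \<in> X \<rightarrow>\<^bsub>C\<^esub> X"
  by (simp add: arrows_iff ident_in_hom)

lemma cmp_arrow: "f \<in> X \<rightarrow>\<^bsub>C\<^esub> Y \<Longrightarrow> g \<in> Y \<rightarrow>\<^bsub>C\<^esub> Z \<Longrightarrow> g \<cdot>\<^bsub>C\<^esub> f \<in> X \<rightarrow>\<^bsub>C\<^esub> Z"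
  by (auto simp: arrows_iff intro: cmp_in_hom)

lemma ident_left: "f \<in> X \<rightarrow>\<^bsub>C\<^esub> Y \<Longrightarrow> Ident C Y \<cdot>\<^bsub>C\<^esub> f = f"
  and ident_right: "f \<in> X \<rightarrow>\<^bsub>C\<^esub> Y \<Longrightarrow> f \<cdot>\<^bsub>C\<^esub> Ident C X = f"
  by (auto simp: arrows_iff cmp_ident_left cmp_ident_right)

lemma assoc:
  assumes "f \<in> W \<rightarrow>\<^bsub>C\<^esub> X" "g \<in> X \<rightarrow>\<^bsub>C\<^esub> Y" "h \<in> Y \<rightarrow>\<^bsub>C\<^esub> Z"
  shows "(h \<cdot>\<^bsub>C\<^esub> g) \<cdot>\<^bsub>C\<^esub> f = h \<cdot>\<^bsub>C\<^esub> (g \<cdot>\<^bsub>C\<^esub> f)"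
  using assms cmp_assoc unfolding arrows_iff by blast

end

context cat_functor
begin

lemma fmap_arrow: "f \<in> X \<rightarrow>\<^bsub>C\<^esub> Y \<Longrightarrow> FMap F X Y f \<in> FObj F X \<rightarrow>\<^bsub>D\<^esub> FObj F Y"
  by (auto simp: arrows_iff fobj_in_obj fmap_in_hom)

lemma fmap_comp: "f \<in> X \<rightarrow>\<^bsub>C\<^esub> Y \<Longrightarrow> g \<in> Y \<rightarrow>\<^bsub>C\<^esub> Z \<Longrightarrow>
    FMap F X Z (g \<cdot>\<^bsub>C\<^esub> f) = FMap F Y Z g \<cdot>\<^bsub>D\<^esub> FMap F X Y f"
  by (auto simp: arrows_iff fmap_cmp)

end

context adjunction
begin

lemma unit_arrow: "X \<in> Obj B \<Longrightarrow> \<eta> X \<in> X \<rightarrow>\<^bsub>B\<^esub> FObj R (FObj L X)"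
  using unit.component_in_hom[of X]
  by (simp add: arrows_iff id_functor_def comp_functor_def L.fobj_in_obj R.fobj_in_obj)

lemma counit_arrow: "Y \<in> Obj A \<Longrightarrow> \<epsilon> Y \<in> FObj L (FObj R Y) \<rightarrow>\<^bsub>A\<^esub> Y"
  using counit.component_in_hom[of Y]
  by (simp add: arrows_iff id_functor_def comp_functor_def L.fobj_in_obj R.fobj_in_obj)

lemma unit_natural: "f \<in> X \<rightarrow>\<^bsub>B\<^esub> Y \<Longrightarrow>
    FMap R (FObj L X) (FObj L Y) (FMap L X Y f) \<cdot>\<^bsub>B\<^esub> \<eta> X = \<eta> Y \<cdot>\<^bsub>B\<^esub> f"
  using unit.naturality[of X Y f]
  by (simp add: arrows_iff id_functor_def comp_functor_def)

lemma counit_natural: "h \<in> Y \<rightarrow>\<^bsub>A\<^esub> Z \<Longrightarrow>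
    h \<cdot>\<^bsub>A\<^esub> \<epsilon> Y = \<epsilon> Z \<cdot>\<^bsub>A\<^esub> FMap L (FObj R Y) (FObj R Z) (FMap R Y Z h)"
  using counit.naturality[of Y Z h]
  by (simp add: arrows_iff id_functor_def comp_functor_def)

text \<open>
  The transpose of \<open>g : X \<rightarrow> R Y\<close> is \<open>\<epsilon> Y \<cdot> L g\<close>, the cotranspose of \<open>h : L X \<rightarrow> Y\<close> is \<open>R h \<cdot> \<eta> X\<close>.
\<close>

lemma transpose_arrow: "g \<in> X \<rightarrow>\<^bsub>B\<^esub> FObj R Y \<Longrightarrow> Y \<in> Obj A \<Longrightarrow>
    \<epsilon> Y \<cdot>\<^bsub>A\<^esub> FMap L X (FObj R Y) g \<in> FObj L X \<rightarrow>\<^bsub>A\<^esub> Y"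
  by (meson L.fmap_arrow L.D.cmp_arrow counit_arrow)

lemma cotranspose_arrow: "X \<in> Obj B \<Longrightarrow> h \<in> FObj L X \<rightarrow>\<^bsub>A\<^esub> Y \<Longrightarrow>
    FMap R (FObj L X) Y h \<cdot>\<^bsub>B\<^esub> \<eta> X \<in> X \<rightarrow>\<^bsub>B\<^esub> FObj R Y"
  by (meson R.fmap_arrow L.C.cmp_arrow unit_arrow)

lemma cotranspose_transpose:
  assumes "g \<in> X \<rightarrow>\<^bsub>B\<^esub> FObj R Y" "Y \<in> Obj A"
  shows "FMap R (FObj L X) Y (\<epsilon> Y \<cdot>\<^bsub>A\<^esub> FMap L X (FObj R Y) g) \<cdot>\<^bsub>B\<^esub> \<eta> X = g"
proof -
  let ?RY = "FObj R Y"
  have X: "X \<in> Obj B" and RY: "?RY \<in> Obj B" using assms arrows_dom arrows_cod by metis+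
  note Lg = L.fmap_arrow[OF assms(1)]
  have "FMap R (FObj L X) Y (\<epsilon> Y \<cdot>\<^bsub>A\<^esub> FMap L X ?RY g) \<cdot>\<^bsub>B\<^esub> \<eta> X
      = FMap R (FObj L ?RY) Y (\<epsilon> Y) \<cdot>\<^bsub>B\<^esub>
        (FMap R (FObj L X) (FObj L ?RY) (FMap L X ?RY g) \<cdot>\<^bsub>B\<^esub> \<eta> X)"
    using R.fmap_comp[OF Lg counit_arrow[OF assms(2)]]
      L.C.assoc[OF unit_arrow[OF X] R.fmap_arrow[OF Lg] R.fmap_arrow[OF counit_arrow[OF assms(2)]]]
    by simp
  also have "\<dots> = (FMap R (FObj L ?RY) Y (\<epsilon> Y) \<cdot>\<^bsub>B\<^esub> \<eta> ?RY) \<cdot>\<^bsub>B\<^esub> g"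
    using unit_natural[OF assms(1)]
      L.C.assoc[OF assms(1) unit_arrow[OF RY] R.fmap_arrow[OF counit_arrow[OF assms(2)]]]
    by simp
  also have "\<dots> = g"
    using triangle_right[OF assms(2)] L.C.ident_left[OF assms(1)] by simp
  finally show ?thesis .
qed

lemma transpose_cotranspose:
  assumes "X \<in> Obj B" "h \<in> FObj L X \<rightarrow>\<^bsub>A\<^esub> Y"
  shows "\<epsilon> Y \<cdot>\<^bsub>A\<^esub> FMap L X (FObj R Y) (FMap R (FObj L X) Y h \<cdot>\<^bsub>B\<^esub> \<eta> X) = h"
proof -
  let ?RLX = "FObj R (FObj L X)"
  have Y: "Y \<in> Obj A" and LX: "FObj L X \<in> Obj A" using assms(2) by (auto simp: arrows_iff)
  note u = unit_arrow[OF assms(1)] and Rh = R.fmap_arrow[OF assms(2)]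
  have "\<epsilon> Y \<cdot>\<^bsub>A\<^esub> FMap L X (FObj R Y) (FMap R (FObj L X) Y h \<cdot>\<^bsub>B\<^esub> \<eta> X)
      = (\<epsilon> Y \<cdot>\<^bsub>A\<^esub> FMap L ?RLX (FObj R Y) (FMap R (FObj L X) Y h)) \<cdot>\<^bsub>A\<^esub> FMap L X ?RLX (\<eta> X)"
    using L.fmap_comp[OF u Rh] L.D.assoc[OF L.fmap_arrow[OF u] L.fmap_arrow[OF Rh] counit_arrow[OF Y]]
    by simp
  also have "\<dots> = h \<cdot>\<^bsub>A\<^esub> (\<epsilon> (FObj L X) \<cdot>\<^bsub>A\<^esub> FMap L X ?RLX (\<eta> X))"
    using counit_natural[OF assms(2)] L.D.assoc[OF L.fmap_arrow[OF u] counit_arrow[OF LX] assms(2)]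
    by simp
  also have "\<dots> = h"
    using triangle_left[OF assms(1)] L.D.ident_right[OF assms(2)] by simp
  finally show ?thesis .
qed

lemma cotranspose_inject:
  assumes "X \<in> Obj B" "h \<in> FObj L X \<rightarrow>\<^bsub>A\<^esub> Y" "h' \<in> FObj L X \<rightarrow>\<^bsub>A\<^esub> Y"
    and "FMap R (FObj L X) Y h \<cdot>\<^bsub>B\<^esub> \<eta> X = FMap R (FObj L X) Y h' \<cdot>\<^bsub>B\<^esub> \<eta> X"
  shows "h = h'"
  using assms transpose_cotranspose by metis

lemma transpose_inject:
  assumes "Y \<in> Obj A" "g \<in> X \<rightarrow>\<^bsub>B\<^esub> FObj R Y" "g' \<in> X \<rightarrow>\<^bsub>B\<^esub> FObj R Y"
    and "\<epsilon> Y \<cdot>\<^bsub>A\<^esub> FMap L X (FObj R Y) g = \<epsilon> Y \<cdot>\<^bsub>A\<^esub> FMap L X (FObj R Y) g'"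
  shows "g = g'"
  using assms cotranspose_transpose by metis

text \<open>
  Both sides of the first equation are transposes of arrows \<open>R M \<rightarrow> R Y\<close>: the left one of \<open>g \<cdot> b\<close>, the
  right one of \<open>R h\<close> by naturality of the counit.  It translates the condition that \<open>h\<close> coequalizes a
  pair, which lives in \<open>A\<close>, into the condition that \<open>g\<close> respects structure arrows, which
  lives in \<open>B\<close>.
\<close>

lemma transpose_square:
  assumes "b \<in> FObj R M \<rightarrow>\<^bsub>B\<^esub> X" "g \<in> X \<rightarrow>\<^bsub>B\<^esub> FObj R Y" "h \<in> M \<rightarrow>\<^bsub>A\<^esub> Y"
  shows "(\<epsilon> Y \<cdot>\<^bsub>A\<^esub> FMap L X (FObj R Y) g) \<cdot>\<^bsub>A\<^esub> FMap L (FObj R M) X b = h \<cdot>\<^bsub>A\<^esub> \<epsilon> M \<longleftrightarrow>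
    g \<cdot>\<^bsub>B\<^esub> b = FMap R M Y h"
proof -
  have Y: "Y \<in> Obj A" using assms by (auto simp: arrows_iff)
  have "(\<epsilon> Y \<cdot>\<^bsub>A\<^esub> FMap L X (FObj R Y) g) \<cdot>\<^bsub>A\<^esub> FMap L (FObj R M) X b
      = \<epsilon> Y \<cdot>\<^bsub>A\<^esub> FMap L (FObj R M) (FObj R Y) (g \<cdot>\<^bsub>B\<^esub> b)"
    using L.fmap_comp[OF assms(1,2)]
      L.D.assoc[OF L.fmap_arrow[OF assms(1)] L.fmap_arrow[OF assms(2)] counit_arrow[OF Y]] by simp
  then show ?thesis
    using counit_natural[OF assms(3)] R.fmap_arrow[OF assms(3)] L.C.cmp_arrow[OF assms(1,2)]
      transpose_inject[OF Y] by metis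
qed

end

text \<open>
  Every identity between arrows out of some \<open>L X\<close> (functoriality of \<open>L\<close>, naturality of
  \<open>\<epsilon>\<close>, the first triangle) can be tested after applying \<open>R\<close> and precomposing with \<open>\<eta> X\<close>, where it
  reduces to the equations that define \<open>L\<close> on arrows and \<open>\<epsilon>\<close>.
\<close>

lemma adjunction_from_universal_arrows:
  assumes "category B" and "cat_functor A B R"
    and L: "\<And>X. X \<in> Obj B \<Longrightarrow> FObj L X \<in> Obj A"
    and \<eta>: "\<And>X. X \<in> Obj B \<Longrightarrow> \<eta> X \<in> X \<rightarrow>\<^bsub>B\<^esub> FObj R (FObj L X)"
    and inject: "\<And>X Y h h'. X \<in> Obj B \<Longrightarrow> h \<in> FObj L X \<rightarrow>\<^bsub>A\<^esub> Y \<Longrightarrow> h' \<in> FObj L X \<rightarrow>\<^bsub>A\<^esub> Y \<Longrightarrow>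
      FMap R (FObj L X) Y h \<cdot>\<^bsub>B\<^esub> \<eta> X = FMap R (FObj L X) Y h' \<cdot>\<^bsub>B\<^esub> \<eta> X \<Longrightarrow> h = h'"
    and Lf: "\<And>X Y f. f \<in> X \<rightarrow>\<^bsub>B\<^esub> Y \<Longrightarrow> FMap L X Y f \<in> FObj L X \<rightarrow>\<^bsub>A\<^esub> FObj L Y"
    and Lf_eq: "\<And>X Y f. f \<in> X \<rightarrow>\<^bsub>B\<^esub> Y \<Longrightarrow>
      FMap R (FObj L X) (FObj L Y) (FMap L X Y f) \<cdot>\<^bsub>B\<^esub> \<eta> X = \<eta> Y \<cdot>\<^bsub>B\<^esub> f"
    and \<epsilon>: "\<And>Y. Y \<in> Obj A \<Longrightarrow> \<epsilon> Y \<in> FObj L (FObj R Y) \<rightarrow>\<^bsub>A\<^esub> Y"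
    and \<epsilon>_eq: "\<And>Y. Y \<in> Obj A \<Longrightarrow>
      FMap R (FObj L (FObj R Y)) Y (\<epsilon> Y) \<cdot>\<^bsub>B\<^esub> \<eta> (FObj R Y) = Ident B (FObj R Y)"
  shows "adjunction A B L R \<eta> \<epsilon>"
proof -
  interpret R: cat_functor A B R by fact
  have R_cmp_\<eta>: "FMap R (FObj L X) Z (k \<cdot>\<^bsub>A\<^esub> h) \<cdot>\<^bsub>B\<^esub> \<eta> X
      = FMap R Y Z k \<cdot>\<^bsub>B\<^esub> (FMap R (FObj L X) Y h \<cdot>\<^bsub>B\<^esub> \<eta> X)"
    if "X \<in> Obj B" "h \<in> FObj L X \<rightarrow>\<^bsub>A\<^esub> Y" "k \<in> Y \<rightarrow>\<^bsub>A\<^esub> Z" for X Y Z h k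
    using R.fmap_comp[OF that(2,3)]
      R.D.assoc[OF \<eta>[OF that(1)] R.fmap_arrow[OF that(2)] R.fmap_arrow[OF that(3)]] by simp
  have L_id: "FMap L X X (Ident B X) = Ident A (FObj L X)" if X: "X \<in> Obj B" for X
  proof (rule inject[OF X Lf[OF R.D.ident_arrow[OF X]] R.C.ident_arrow[OF L[OF X]]])
    show "FMap R (FObj L X) (FObj L X) (FMap L X X (Ident B X)) \<cdot>\<^bsub>B\<^esub> \<eta> X
        = FMap R (FObj L X) (FObj L X) (Ident A (FObj L X)) \<cdot>\<^bsub>B\<^esub> \<eta> X"
      using Lf_eq[OF R.D.ident_arrow[OF X]] R.fmap_ident[OF L[OF X]]
        R.D.ident_left[OF \<eta>[OF X]] R.D.ident_right[OF \<eta>[OF X]] by simp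
  qed
  have L_cmp: "FMap L X Z (g \<cdot>\<^bsub>B\<^esub> f) = FMap L Y Z g \<cdot>\<^bsub>A\<^esub> FMap L X Y f"
    if f: "f \<in> X \<rightarrow>\<^bsub>B\<^esub> Y" and g: "g \<in> Y \<rightarrow>\<^bsub>B\<^esub> Z" for X Y Z f g
  proof -
    have X: "X \<in> Obj B" and Y: "Y \<in> Obj B" and Z: "Z \<in> Obj B"
      using f g by (auto simp: arrows_iff)
    show ?thesis
    proof (rule inject[OF X Lf[OF R.D.cmp_arrow[OF f g]] R.C.cmp_arrow[OF Lf[OF f] Lf[OF g]]])
      show "FMap R (FObj L X) (FObj L Z) (FMap L X Z (g \<cdot>\<^bsub>B\<^esub> f)) \<cdot>\<^bsub>B\<^esub> \<eta> X
        = FMap R (FObj L X) (FObj L Z) (FMap L Y Z g \<cdot>\<^bsub>A\<^esub> FMap L X Y f) \<cdot>\<^bsub>B\<^esub> \<eta> X"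
        using Lf_eq[OF R.D.cmp_arrow[OF f g]] R_cmp_\<eta>[OF X Lf[OF f] Lf[OF g]] Lf_eq[OF f] Lf_eq[OF g]
          R.D.assoc[OF f \<eta>[OF Y] R.fmap_arrow[OF Lf[OF g]]] R.D.assoc[OF f g \<eta>[OF Z]] by simp
    qed
  qed
  interpret L: cat_functor B A L
    by unfold_locales (use L L_id L_cmp Lf in \<open>auto simp: arrows_iff\<close>)
  have \<epsilon>_nat: "h \<cdot>\<^bsub>A\<^esub> \<epsilon> Y = \<epsilon> Z \<cdot>\<^bsub>A\<^esub> FMap L (FObj R Y) (FObj R Z) (FMap R Y Z h)"
    if h: "h \<in> Y \<rightarrow>\<^bsub>A\<^esub> Z" for Y Z h
  proof -
    have Y: "Y \<in> Obj A" and Z: "Z \<in> Obj A" using h by (auto simp: arrows_iff)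
    note Rh = R.fmap_arrow[OF h] and LRh = L.fmap_arrow[OF R.fmap_arrow[OF h]]
    show ?thesis
    proof (rule inject[OF R.fobj_in_obj[OF Y] R.C.cmp_arrow[OF \<epsilon>[OF Y] h] R.C.cmp_arrow[OF LRh \<epsilon>[OF Z]]])
      show "FMap R (FObj L (FObj R Y)) Z (h \<cdot>\<^bsub>A\<^esub> \<epsilon> Y) \<cdot>\<^bsub>B\<^esub> \<eta> (FObj R Y)
        = FMap R (FObj L (FObj R Y)) Z (\<epsilon> Z \<cdot>\<^bsub>A\<^esub> FMap L (FObj R Y) (FObj R Z) (FMap R Y Z h))
            \<cdot>\<^bsub>B\<^esub> \<eta> (FObj R Y)"
        using R_cmp_\<eta>[OF R.fobj_in_obj[OF Y] \<epsilon>[OF Y] h] R_cmp_\<eta>[OF R.fobj_in_obj[OF Y] LRh \<epsilon>[OF Z]]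
          Lf_eq[OF Rh] \<epsilon>_eq[OF Y] \<epsilon>_eq[OF Z] R.D.ident_left[OF Rh] R.D.ident_right[OF Rh]
          R.D.assoc[OF Rh \<eta>[OF R.fobj_in_obj[OF Z]] R.fmap_arrow[OF \<epsilon>[OF Z]]] by simp
    qed
  qed
  have triangle: "\<epsilon> (FObj L X) \<cdot>\<^bsub>A\<^esub> FMap L X (FObj R (FObj L X)) (\<eta> X) = Ident A (FObj L X)"
    if X: "X \<in> Obj B" for X
  proof (rule inject[OF X])
    note LX = L[OF X] and Le = L.fmap_arrow[OF \<eta>[OF X]]
    show "\<epsilon> (FObj L X) \<cdot>\<^bsub>A\<^esub> FMap L X (FObj R (FObj L X)) (\<eta> X) \<in> FObj L X \<rightarrow>\<^bsub>A\<^esub> FObj L X"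
      using R.C.cmp_arrow[OF Le \<epsilon>[OF LX]] .
    show "Ident A (FObj L X) \<in> FObj L X \<rightarrow>\<^bsub>A\<^esub> FObj L X" using R.C.ident_arrow[OF LX] .
    show "FMap R (FObj L X) (FObj L X) (\<epsilon> (FObj L X) \<cdot>\<^bsub>A\<^esub> FMap L X (FObj R (FObj L X)) (\<eta> X)) \<cdot>\<^bsub>B\<^esub> \<eta> X
        = FMap R (FObj L X) (FObj L X) (Ident A (FObj L X)) \<cdot>\<^bsub>B\<^esub> \<eta> X"
      using R_cmp_\<eta>[OF X Le \<epsilon>[OF LX]] Lf_eq[OF \<eta>[OF X]] \<epsilon>_eq[OF LX] R.fmap_ident[OF LX]
        R.D.assoc[OF \<eta>[OF X] \<eta>[OF R.fobj_in_obj[OF LX]] R.fmap_arrow[OF \<epsilon>[OF LX]]] by simp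
  qed
  show ?thesis
    by unfold_locales
      (use \<eta> \<epsilon> Lf_eq \<epsilon>_eq \<epsilon>_nat triangle L_id L_cmp in \<open>auto simp: arrows_iff id_functor_def comp_functor_def
        L.fobj_in_obj R.fobj_in_obj L.fmap_in_hom R.fmap_in_hom R.fmap_ident R.fmap_cmp\<close>)
qed

context adjunction
begin

text \<open>
  By fullness the counit at \<open>L X\<close> is \<open>L e\<close> for some \<open>e : R (L X) \<rightarrow> X\<close>.  Then \<open>L (e \<cdot> \<eta> X)\<close> is an identity by a
  triangle, hence so is \<open>e \<cdot> \<eta> X\<close> by faithfulness; naturality of the unit at \<open>e\<close> and the other
  triangle give the second equation.
\<close>

lemma unit_iso_if_fully_faithful:
  assumes "fully_faithful B A L" and X: "X \<in> Obj B"
  obtains e where "e \<in> FObj R (FObj L X) \<rightarrow>\<^bsub>B\<^esub> X"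
    and "e \<cdot>\<^bsub>B\<^esub> \<eta> X = Ident B X" and "\<eta> X \<cdot>\<^bsub>B\<^esub> e = Ident B (FObj R (FObj L X))"
proof -
  interpret L': fully_faithful B A L by fact
  let ?LX = "FObj L X" and ?RLX = "FObj R (FObj L X)"
  have LX: "?LX \<in> Obj A" and RLX: "?RLX \<in> Obj B" using X L.fobj_in_obj R.fobj_in_obj by auto
  note u = unit_arrow[OF X] and c = counit_arrow[OF LX]
  have "\<epsilon> ?LX \<in> FMap L ?RLX X ` Hom B ?RLX X"
    using c L'.fmap_bij[OF RLX X] by (auto simp: bij_betw_def arrows_iff)
  then obtain e where e: "e \<in> ?RLX \<rightarrow>\<^bsub>B\<^esub> X" and Le: "FMap L ?RLX X e = \<epsilon> ?LX"
    using X RLX by (auto simp: arrows_iff)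
  have "FMap L X X (e \<cdot>\<^bsub>B\<^esub> \<eta> X) = FMap L X X (Ident B X)"
    using L.fmap_comp[OF u e] Le triangle_left[OF X] L.fmap_ident[OF X] by simp
  then have left: "e \<cdot>\<^bsub>B\<^esub> \<eta> X = Ident B X"
    using L'.fmap_bij[OF X X] L.C.cmp_arrow[OF u e] L.C.ident_arrow[OF X]
    by (auto simp: bij_betw_def arrows_iff dest: inj_onD)
  have "\<eta> X \<cdot>\<^bsub>B\<^esub> e = Ident B ?RLX"
    using unit_natural[OF e] Le triangle_right[OF LX] by simp
  with e left show thesis by (rule that)
qed

text \<open>
  Transport of structure for algebras over the monad \<open>T = R \<circ> L\<close> with multiplication \<open>m = R \<epsilon> L\<close>: an
  isomorphism \<open>f : W \<rightarrow> V\<close> carries the algebra \<open>\<mu>\<close> on \<open>W\<close> to an algebra on \<open>V\<close>.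
\<close>

lemma algebra_transport:
  defines "T \<equiv> \<lambda>X Y f. FMap R (FObj L X) (FObj L Y) (FMap L X Y f)"
    and "m \<equiv> \<lambda>X. FMap R (FObj L (FObj R (FObj L X))) (FObj L X) (\<epsilon> (FObj L X))"
  assumes \<mu>: "\<mu> \<in> FObj R (FObj L W) \<rightarrow>\<^bsub>B\<^esub> W" and unit: "\<mu> \<cdot>\<^bsub>B\<^esub> \<eta> W = Ident B W"
    and mult: "\<mu> \<cdot>\<^bsub>B\<^esub> T (FObj R (FObj L W)) W \<mu> = \<mu> \<cdot>\<^bsub>B\<^esub> m W"
    and f: "f \<in> W \<rightarrow>\<^bsub>B\<^esub> V" and g: "g \<in> V \<rightarrow>\<^bsub>B\<^esub> W"
    and gf: "g \<cdot>\<^bsub>B\<^esub> f = Ident B W" and fg: "f \<cdot>\<^bsub>B\<^esub> g = Ident B V"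
    and \<mu>': "\<mu>' = f \<cdot>\<^bsub>B\<^esub> (\<mu> \<cdot>\<^bsub>B\<^esub> T V W g)"
  shows "\<mu>' \<in> FObj R (FObj L V) \<rightarrow>\<^bsub>B\<^esub> V" and "\<mu>' \<cdot>\<^bsub>B\<^esub> \<eta> V = Ident B V"
    and "\<mu>' \<cdot>\<^bsub>B\<^esub> T (FObj R (FObj L V)) V \<mu>' = \<mu>' \<cdot>\<^bsub>B\<^esub> m V"
proof -
  let ?TV = "FObj R (FObj L V)" and ?TW = "FObj R (FObj L W)"
  define \<nu> where "\<nu> = \<mu> \<cdot>\<^bsub>B\<^esub> T V W g"
  have T: "T X Y h \<in> FObj R (FObj L X) \<rightarrow>\<^bsub>B\<^esub> FObj R (FObj L Y)" if "h \<in> X \<rightarrow>\<^bsub>B\<^esub> Y" for X Y h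
    unfolding T_def by (rule R.fmap_arrow[OF L.fmap_arrow[OF that]])
  have T_comp: "T X Z (k \<cdot>\<^bsub>B\<^esub> h) = T Y Z k \<cdot>\<^bsub>B\<^esub> T X Y h"
    if "h \<in> X \<rightarrow>\<^bsub>B\<^esub> Y" "k \<in> Y \<rightarrow>\<^bsub>B\<^esub> Z" for X Y Z h k
    unfolding T_def using L.fmap_comp[OF that] R.fmap_comp[OF that[THEN L.fmap_arrow]] by simp
  have V: "V \<in> Obj B" and W: "W \<in> Obj B" using f by (auto simp: arrows_iff)
  have LV: "FObj L V \<in> Obj A" and LW: "FObj L W \<in> Obj A" using V W L.fobj_in_obj by auto
  have m: "m X \<in> FObj R (FObj L (FObj R (FObj L X))) \<rightarrow>\<^bsub>B\<^esub> FObj R (FObj L X)" if "X \<in> Obj B" for X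
    unfolding m_def by (rule R.fmap_arrow[OF counit_arrow[OF L.fobj_in_obj[OF that]]])
  note Tg = T[OF g] and Tf = T[OF f] and TTg = T[OF T[OF g]] and T\<mu> = T[OF \<mu>]
  have \<nu>: "\<nu> \<in> ?TV \<rightarrow>\<^bsub>B\<^esub> W" unfolding \<nu>_def by (rule L.C.cmp_arrow[OF Tg \<mu>])
  note T\<nu> = T[OF \<nu>]
  have \<mu>'_eq: "\<mu>' = f \<cdot>\<^bsub>B\<^esub> \<nu>" using \<mu>' \<nu>_def by simp
  show "\<mu>' \<in> ?TV \<rightarrow>\<^bsub>B\<^esub> V" unfolding \<mu>'_eq by (rule L.C.cmp_arrow[OF \<nu> f])
  have "\<nu> \<cdot>\<^bsub>B\<^esub> \<eta> V = \<mu> \<cdot>\<^bsub>B\<^esub> (\<eta> W \<cdot>\<^bsub>B\<^esub> g)"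
    unfolding \<nu>_def using L.C.assoc[OF unit_arrow[OF V] Tg \<mu>] unit_natural[OF g] by (simp add: T_def)
  also have "\<dots> = g" using L.C.assoc[OF g unit_arrow[OF W] \<mu>] unit L.C.ident_left[OF g] by simp
  finally show "\<mu>' \<cdot>\<^bsub>B\<^esub> \<eta> V = Ident B V"
    unfolding \<mu>'_eq using L.C.assoc[OF unit_arrow[OF V] \<nu> f] fg by simp
  \<comment> \<open>The inner \<open>T g \<cdot> T f\<close> cancels, which leaves associativity of \<open>\<mu>\<close> and naturality of \<open>m\<close> at \<open>g\<close>.\<close>
  have "\<nu> \<cdot>\<^bsub>B\<^esub> T ?TV V \<mu>' = (\<nu> \<cdot>\<^bsub>B\<^esub> T W V f) \<cdot>\<^bsub>B\<^esub> T ?TV W \<nu>"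
    unfolding \<mu>'_eq using T_comp[OF \<nu> f] L.C.assoc[OF T\<nu> Tf \<nu>] by simp
  also have "\<nu> \<cdot>\<^bsub>B\<^esub> T W V f = \<mu> \<cdot>\<^bsub>B\<^esub> T W W (g \<cdot>\<^bsub>B\<^esub> f)"
    unfolding \<nu>_def using L.C.assoc[OF Tf Tg \<mu>] T_comp[OF f g] by simp
  also have "\<dots> = \<mu>"
    unfolding gf T_def L.fmap_ident[OF W] R.fmap_ident[OF LW] by (rule L.C.ident_right[OF \<mu>])
  also have "\<mu> \<cdot>\<^bsub>B\<^esub> T ?TV W \<nu> = (\<mu> \<cdot>\<^bsub>B\<^esub> T ?TW W \<mu>) \<cdot>\<^bsub>B\<^esub> T ?TV ?TW (T V W g)"
    unfolding \<nu>_def using T_comp[OF Tg \<mu>] L.C.assoc[OF TTg T\<mu> \<mu>] by simp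
  also have "\<dots> = \<mu> \<cdot>\<^bsub>B\<^esub> (m W \<cdot>\<^bsub>B\<^esub> T ?TV ?TW (T V W g))"
    using mult L.C.assoc[OF TTg m[OF W] \<mu>] by simp
  also have "m W \<cdot>\<^bsub>B\<^esub> T ?TV ?TW (T V W g) = T V W g \<cdot>\<^bsub>B\<^esub> m V"
    unfolding T_def m_def using counit_natural[OF L.fmap_arrow[OF g]]
      R.fmap_comp[OF counit_arrow[OF LV] L.fmap_arrow[OF g]]
      R.fmap_comp[OF L.fmap_arrow[OF Tg] counit_arrow[OF LW]] by (simp add: T_def)
  also have "\<mu> \<cdot>\<^bsub>B\<^esub> (T V W g \<cdot>\<^bsub>B\<^esub> m V) = \<nu> \<cdot>\<^bsub>B\<^esub> m V"
    unfolding \<nu>_def using L.C.assoc[OF m[OF V] Tg \<mu>] by simp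
  finally have "\<nu> \<cdot>\<^bsub>B\<^esub> T ?TV V \<mu>' = \<nu> \<cdot>\<^bsub>B\<^esub> m V" .
  moreover have "T ?TV V \<mu>' \<in> FObj R (FObj L ?TV) \<rightarrow>\<^bsub>B\<^esub> ?TV"
    unfolding \<mu>'_eq by (rule T[OF L.C.cmp_arrow[OF \<nu> f]])
  ultimately show "\<mu>' \<cdot>\<^bsub>B\<^esub> T ?TV V \<mu>' = \<mu>' \<cdot>\<^bsub>B\<^esub> m V"
    unfolding \<mu>'_eq using L.C.assoc[OF _ \<nu> f] m[OF V] by metis
qed

end


section \<open>Stages over the base category\<close>

text \<open>
  The properties that hold at every stage of either tower.  The category is concrete over \<open>B\<close>: an
  arrow is literally an arrow of \<open>B\<close> between the underlying objects, so composition,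
  identities and the action of \<open>Rgt S\<close> on arrows are those of \<open>B\<close> and \<open>R\<close>.  The last three assumptions say that \<open>Proj S\<close>
  is the transformation \<open>L \<circ> base \<rightarrow> Lft S\<close> through which the counit \<open>\<epsilon>\<close> factors;
  carrying it along in both towers lets them share one notion of stage.
\<close>

locale tower_stage =
  base: adjunction A B L R \<eta> \<epsilon> +
  adjunction A "Cat S" "Lft S" "Rgt S" "Unit S" "Counit S"
  for A :: "('p, 'n) category_data" and B :: "('o, 'm) category_data"
    and L :: "('o, 'm, 'p, 'n) functor_data" and R :: "('p, 'n, 'o, 'm) functor_data"
    and \<eta> :: "'o \<Rightarrow> 'm" and \<epsilon> :: "'p \<Rightarrow> 'n"
    and S :: "('o, 'm, 'p, 'n) stage" +
  assumes base_in_obj: "V \<in> Obj (Cat S) \<Longrightarrow> base V \<in> Obj B"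
    and hom_base: "V \<in> Obj (Cat S) \<Longrightarrow> W \<in> Obj (Cat S) \<Longrightarrow> Hom (Cat S) V W \<subseteq> Hom B (base V) (base W)"
    and Ident_Cat: "V \<in> Obj (Cat S) \<Longrightarrow> Ident (Cat S) V = Ident B (base V)"
    and Cmp_Cat: "Cmp (Cat S) = Cmp B"
    and base_Rgt: "base (FObj (Rgt S) Y) = FObj R Y"
    and FMap_Rgt: "FMap (Rgt S) = FMap R"
    and Proj_arrow: "V \<in> Obj (Cat S) \<Longrightarrow> Proj S V \<in> FObj L (base V) \<rightarrow>\<^bsub>A\<^esub> FObj (Lft S) V"
    and Proj_natural: "f \<in> V \<rightarrow>\<^bsub>Cat S\<^esub> W \<Longrightarrow>
      FMap (Lft S) V W f \<cdot>\<^bsub>A\<^esub> Proj S V = Proj S W \<cdot>\<^bsub>A\<^esub> FMap L (base V) (base W) f"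
    and Counit_Proj: "Y \<in> Obj A \<Longrightarrow> Counit S Y \<cdot>\<^bsub>A\<^esub> Proj S (FObj (Rgt S) Y) = \<epsilon> Y"
begin

lemma base_arrow: "f \<in> V \<rightarrow>\<^bsub>Cat S\<^esub> W \<Longrightarrow> f \<in> base V \<rightarrow>\<^bsub>B\<^esub> base W"
  using base_in_obj hom_base by (fastforce simp: arrows_iff)

text \<open>
  The facts about the adjunction of the stage, with composition and the right adjoint on arrows
  rewritten to those of \<open>B\<close> and \<open>R\<close>.
\<close>

lemmas stage_assoc = L.C.assoc[unfolded Cmp_Cat]
lemmas stage_cmp_arrow = L.C.cmp_arrow[unfolded Cmp_Cat]
lemmas stage_unit_natural = unit_natural[unfolded Cmp_Cat FMap_Rgt]
lemmas stage_counit_natural = counit_natural[unfolded FMap_Rgt]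
lemmas stage_cotranspose_arrow = cotranspose_arrow[unfolded Cmp_Cat FMap_Rgt]
lemmas stage_cotranspose_inject = cotranspose_inject[unfolded Cmp_Cat FMap_Rgt]
lemmas stage_cotranspose_transpose = cotranspose_transpose[unfolded Cmp_Cat FMap_Rgt]
lemmas stage_transpose_cotranspose = transpose_cotranspose[unfolded Cmp_Cat FMap_Rgt]
lemmas stage_transpose_square = transpose_square[unfolded Cmp_Cat FMap_Rgt]
lemmas stage_Rgt_arrow = R.fmap_arrow[unfolded FMap_Rgt]

lemma stage_triangle: "Y \<in> Obj A \<Longrightarrow>
    FMap R (FObj (Lft S) (FObj (Rgt S) Y)) Y (Counit S Y) \<cdot>\<^bsub>B\<^esub> Unit S (FObj (Rgt S) Y)
      = Ident B (FObj R Y)"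
  using triangle_right[of Y] by (simp add: Cmp_Cat FMap_Rgt Ident_Cat R.fobj_in_obj base_Rgt)

text \<open>
  Let \<open>g\<close> be the cotranspose of \<open>h\<close> at the stage.  Naturality of \<open>Proj S\<close> and \<open>Counit_Proj\<close> show that
  \<open>h \<cdot> Proj S V\<close> is the transpose of \<open>g\<close> for the original adjunction \<open>(L, R)\<close>, to which
  \<open>transpose_square\<close> applies.
\<close>

lemma adj_coequalizes_iff:
  assumes V: "V \<in> Obj (Cat S)" and b: "b \<in> FObj R (FObj (Lft S) V) \<rightarrow>\<^bsub>B\<^esub> base V"
    and h: "h \<in> FObj (Lft S) V \<rightarrow>\<^bsub>A\<^esub> Y"
  shows "h \<cdot>\<^bsub>A\<^esub> (Proj S V \<cdot>\<^bsub>A\<^esub> FMap L (FObj R (FObj (Lft S) V)) (base V) b) = h \<cdot>\<^bsub>A\<^esub> \<epsilon> (FObj (Lft S) V)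
    \<longleftrightarrow> (FMap R (FObj (Lft S) V) Y h \<cdot>\<^bsub>B\<^esub> Unit S V) \<cdot>\<^bsub>B\<^esub> b = FMap R (FObj (Lft S) V) Y h"
proof -
  let ?M = "FObj (Lft S) V" and ?RY = "FObj (Rgt S) Y"
  let ?g = "FMap R ?M Y h \<cdot>\<^bsub>B\<^esub> Unit S V"
  have Y: "Y \<in> Obj A" using h by (auto simp: arrows_iff)
  have g: "?g \<in> V \<rightarrow>\<^bsub>Cat S\<^esub> ?RY" by (rule stage_cotranspose_arrow[OF V h])
  have gB: "?g \<in> base V \<rightarrow>\<^bsub>B\<^esub> FObj R Y" using base_arrow[OF g] by (simp add: base_Rgt)
  have RY: "?RY \<in> Obj (Cat S)" by (rule R.fobj_in_obj[OF Y])
  have Lg: "FMap L (base V) (FObj R Y) ?g \<in> FObj L (base V) \<rightarrow>\<^bsub>A\<^esub> FObj L (FObj R Y)"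
    by (rule base.L.fmap_arrow[OF gB])
  note P = Proj_arrow[OF RY, unfolded base_Rgt]
  have "h \<cdot>\<^bsub>A\<^esub> Proj S V = (Counit S Y \<cdot>\<^bsub>A\<^esub> FMap (Lft S) V ?RY ?g) \<cdot>\<^bsub>A\<^esub> Proj S V"
    using stage_transpose_cotranspose[OF V h] by simp
  also have "\<dots> = Counit S Y \<cdot>\<^bsub>A\<^esub> (Proj S ?RY \<cdot>\<^bsub>A\<^esub> FMap L (base V) (FObj R Y) ?g)"
    using base.L.D.assoc[OF Proj_arrow[OF V] L.fmap_arrow[OF g] counit_arrow[OF Y]] Proj_natural[OF g]
    by (simp add: base_Rgt)
  also have "\<dots> = \<epsilon> Y \<cdot>\<^bsub>A\<^esub> FMap L (base V) (FObj R Y) ?g"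
    using base.L.D.assoc[OF Lg P counit_arrow[OF Y]] Counit_Proj[OF Y] by simp
  finally have "h \<cdot>\<^bsub>A\<^esub> Proj S V = \<epsilon> Y \<cdot>\<^bsub>A\<^esub> FMap L (base V) (FObj R Y) ?g" .
  then show ?thesis
    using base.transpose_square[OF b gB h] base.L.D.assoc[OF base.L.fmap_arrow[OF b] Proj_arrow[OF V] h]
    by simp
qed

text \<open>The right-hand side is that of \<open>adj_coequalizes_iff\<close>; here the adjunction of the stage itself serves.\<close>

lemma monadic_coequalizes_iff:
  assumes V: "V \<in> Obj (Cat S)" and \<mu>: "\<mu> \<in> FObj (Rgt S) (FObj (Lft S) V) \<rightarrow>\<^bsub>Cat S\<^esub> V"
    and h: "h \<in> FObj (Lft S) V \<rightarrow>\<^bsub>A\<^esub> Y"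
  shows "h \<cdot>\<^bsub>A\<^esub> FMap (Lft S) (FObj (Rgt S) (FObj (Lft S) V)) V \<mu> = h \<cdot>\<^bsub>A\<^esub> Counit S (FObj (Lft S) V)
    \<longleftrightarrow> (FMap R (FObj (Lft S) V) Y h \<cdot>\<^bsub>B\<^esub> Unit S V) \<cdot>\<^bsub>B\<^esub> \<mu> = FMap R (FObj (Lft S) V) Y h"
  using stage_transpose_square[OF \<mu> stage_cotranspose_arrow[OF V h] h]
    stage_transpose_cotranspose[OF V h] by simp

end

lemma tower_stage_initial:
  assumes "adjunction A B L R \<eta> \<epsilon>"
  shows "tower_stage A B L R \<eta> \<epsilon> (initial_stage A B L R \<eta> \<epsilon>)"
proof -
  interpret adjunction A B L R \<eta> \<epsilon> by fact
  let ?S = "initial_stage A B L R \<eta> \<epsilon>"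
  have arr: "f \<in> V \<rightarrow>\<^bsub>Cat ?S\<^esub> W \<longleftrightarrow> V \<in> Base ` Obj B \<and> W \<in> Base ` Obj B \<and> f \<in> base V \<rightarrow>\<^bsub>B\<^esub> base W" for f V W
    by (auto simp: initial_stage_def arrows_iff)
  have cat: "Obj (Cat ?S) = Base ` Obj B" "Hom (Cat ?S) V W = Hom B (base V) (base W)"
    "Ident (Cat ?S) V = Ident B (base V)" "Cmp (Cat ?S) = Cmp B" for V W
    by (simp_all add: initial_stage_def)
  have base: "base V \<in> Obj B" if "V \<in> Obj (Cat ?S)" for V using that by (auto simp: cat)
  interpret S: category "Cat ?S"
    by (unfold_locales; (drule base)+; unfold cat;
        rule L.C.ident_in_hom L.C.cmp_in_hom L.C.cmp_ident_left L.C.cmp_ident_right L.C.cmp_assoc; assumption)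
  have Lft: "FObj (Lft ?S) V = FObj L (base V)" "FMap (Lft ?S) V W f = FMap L (base V) (base W) f" for V W f
    by (simp_all add: initial_stage_def)
  interpret Lft: cat_functor "Cat ?S" A "Lft ?S"
    by (unfold_locales; (drule base)+; unfold cat Lft;
        rule L.fobj_in_obj L.fmap_in_hom L.fmap_ident L.fmap_cmp; assumption)
  interpret Rgt: cat_functor A "Cat ?S" "Rgt ?S"
    by unfold_locales
      (simp_all add: initial_stage_def R.fobj_in_obj R.fmap_in_hom R.fmap_ident R.fmap_cmp)
  interpret S: adjunction A "Cat ?S" "Lft ?S" "Rgt ?S" "Unit ?S" "Counit ?S"
  proof (rule adjunction_from_universal_arrows[OF S.category_axioms Rgt.cat_functor_axioms Lft.fobj_in_obj])
    show "Unit ?S X \<in> X \<rightarrow>\<^bsub>Cat ?S\<^esub> FObj (Rgt ?S) (FObj (Lft ?S) X)" if "X \<in> Obj (Cat ?S)" for X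
      unfolding arr using that unit_arrow[OF base[OF that]] L.fobj_in_obj R.fobj_in_obj
      by (auto simp: initial_stage_def)
    show "h = h'" if "X \<in> Obj (Cat ?S)" "h \<in> FObj (Lft ?S) X \<rightarrow>\<^bsub>A\<^esub> Y" "h' \<in> FObj (Lft ?S) X \<rightarrow>\<^bsub>A\<^esub> Y"
      "FMap (Rgt ?S) (FObj (Lft ?S) X) Y h \<cdot>\<^bsub>Cat ?S\<^esub> Unit ?S X
        = FMap (Rgt ?S) (FObj (Lft ?S) X) Y h' \<cdot>\<^bsub>Cat ?S\<^esub> Unit ?S X" for X Y h h'
      by (rule cotranspose_inject[of "base X"]) (use that in \<open>auto simp: initial_stage_def\<close>)
    show "Counit ?S Y \<in> FObj (Lft ?S) (FObj (Rgt ?S) Y) \<rightarrow>\<^bsub>A\<^esub> Y" if "Y \<in> Obj A" for Y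
      using counit_arrow[OF that] by (simp add: initial_stage_def)
    show "FMap (Rgt ?S) (FObj (Lft ?S) (FObj (Rgt ?S) Y)) Y (Counit ?S Y) \<cdot>\<^bsub>Cat ?S\<^esub> Unit ?S (FObj (Rgt ?S) Y)
        = Ident (Cat ?S) (FObj (Rgt ?S) Y)" if "Y \<in> Obj A" for Y
      using triangle_right[OF that] by (simp add: initial_stage_def)
    fix X Y f assume f: "f \<in> X \<rightarrow>\<^bsub>Cat ?S\<^esub> Y"
    show "FMap (Lft ?S) X Y f \<in> FObj (Lft ?S) X \<rightarrow>\<^bsub>A\<^esub> FObj (Lft ?S) Y" by (rule Lft.fmap_arrow[OF f])
    show "FMap (Rgt ?S) (FObj (Lft ?S) X) (FObj (Lft ?S) Y) (FMap (Lft ?S) X Y f) \<cdot>\<^bsub>Cat ?S\<^esub> Unit ?S X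
        = Unit ?S Y \<cdot>\<^bsub>Cat ?S\<^esub> f"
      using f[unfolded arr] unit_natural[of f "base X" "base Y"] by (simp add: initial_stage_def)
  qed
  show ?thesis
  proof
    show "Proj ?S V \<in> FObj L (base V) \<rightarrow>\<^bsub>A\<^esub> FObj (Lft ?S) V" if "V \<in> Obj (Cat ?S)" for V
      using that L.D.ident_arrow[OF L.fobj_in_obj] by (auto simp: initial_stage_def)
    show "FMap (Lft ?S) V W f \<cdot>\<^bsub>A\<^esub> Proj ?S V = Proj ?S W \<cdot>\<^bsub>A\<^esub> FMap L (base V) (base W) f"
      if "f \<in> V \<rightarrow>\<^bsub>Cat ?S\<^esub> W" for f V W
    proof -
      have f: "f \<in> base V \<rightarrow>\<^bsub>B\<^esub> base W" using that by (simp add: arr)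
      show ?thesis
        using L.D.ident_left[OF L.fmap_arrow[OF f]] L.D.ident_right[OF L.fmap_arrow[OF f]]
        by (simp add: initial_stage_def)
    qed
    show "Counit ?S Y \<cdot>\<^bsub>A\<^esub> Proj ?S (FObj (Rgt ?S) Y) = \<epsilon> Y" if "Y \<in> Obj A" for Y
      using L.D.ident_right[OF counit_arrow[OF that]] by (simp add: initial_stage_def)
  qed (auto simp: initial_stage_def)
qed

section \<open>The next stage\<close>

text \<open>
  The step common to both towers.  The new category \<open>C'\<close> is a full subcategory of the
  category of all pairs over the stage, containing the values of the new right adjoint, and \<open>c X\<close> is a coequalizer
  of a pair \<open>s X, t X : x X \<rightarrow> Lft S (under X)\<close>.  The pair itself is left open; all that matters
  is \<open>coequalizes_iff\<close>, that \<open>h\<close> coequalizes it exactly if the cotranspose of \<open>h\<close> satisfies the equation of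
  an arrow of \<open>C'\<close> from \<open>X\<close> to \<open>(Rgt S Y, r Y)\<close>.
\<close>

locale next_tower_stage = tower_stage A B L R \<eta> \<epsilon> S
  for A :: "('p, 'n) category_data" and B :: "('o, 'm) category_data"
    and L :: "('o, 'm, 'p, 'n) functor_data" and R :: "('p, 'n, 'o, 'm) functor_data"
    and \<eta> :: "'o \<Rightarrow> 'm" and \<epsilon> :: "'p \<Rightarrow> 'n"
    and S :: "('o, 'm, 'p, 'n) stage" +
  fixes C' :: "(('o, 'm) tower_obj, 'm) category_data" and r :: "'p \<Rightarrow> 'm"
    and c :: "('o, 'm) tower_obj \<Rightarrow> 'p \<times> 'n"
    and x :: "('o, 'm) tower_obj \<Rightarrow> 'p" and s t :: "('o, 'm) tower_obj \<Rightarrow> 'n"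
  assumes Obj_subset: "Obj C' \<subseteq> Obj (adj_category B R S)"
    and Hom_full: "Hom C' = Hom (adj_category B R S)"
    and Ident_same: "Ident C' = Ident (adj_category B R S)"
    and Cmp_same: "Cmp C' = Cmp (adj_category B R S)"
    and r_eq: "r Y = FMap R (FObj (Lft S) (FObj (Rgt S) Y)) Y (Counit S Y)"
    and Rgt_in_Obj: "Y \<in> Obj A \<Longrightarrow> Ext (FObj (Rgt S) Y) (r Y) \<in> Obj C'"
    and coeq: "X \<in> Obj C' \<Longrightarrow>
      is_coequalizer A (x X) (FObj (Lft S) (under X)) (s X) (t X) (fst (c X)) (snd (c X))"
    and pair_arrow: "X \<in> Obj C' \<Longrightarrow> s X \<in> x X \<rightarrow>\<^bsub>A\<^esub> FObj (Lft S) (under X)"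
      "X \<in> Obj C' \<Longrightarrow> t X \<in> x X \<rightarrow>\<^bsub>A\<^esub> FObj (Lft S) (under X)"
    and coequalizes_iff: "\<And>X Y h. X \<in> Obj C' \<Longrightarrow> h \<in> FObj (Lft S) (under X) \<rightarrow>\<^bsub>A\<^esub> Y \<Longrightarrow>
      h \<cdot>\<^bsub>A\<^esub> s X = h \<cdot>\<^bsub>A\<^esub> t X \<longleftrightarrow>
        (FMap R (FObj (Lft S) (under X)) Y h \<cdot>\<^bsub>B\<^esub> Unit S (under X)) \<cdot>\<^bsub>B\<^esub> str X
          = FMap R (FObj (Lft S) (under X)) Y h"
begin

lemma next_obj:
  assumes "X \<in> Obj C'"
  shows "X = Ext (under X) (str X)" "under X \<in> Obj (Cat S)"
    "str X \<in> FObj R (FObj (Lft S) (under X)) \<rightarrow>\<^bsub>B\<^esub> base X" "base X = base (under X)"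
  using assms Obj_subset L.fobj_in_obj base.R.fobj_in_obj base_in_obj
  by (auto simp: adj_category_def arrows_iff)

lemma next_arrow_iff: "f \<in> X \<rightarrow>\<^bsub>C'\<^esub> Y \<longleftrightarrow> X \<in> Obj C' \<and> Y \<in> Obj C' \<and>
    f \<in> under X \<rightarrow>\<^bsub>Cat S\<^esub> under Y \<and>
    f \<cdot>\<^bsub>B\<^esub> str X = str Y \<cdot>\<^bsub>B\<^esub> FMap R (FObj (Lft S) (under X)) (FObj (Lft S) (under Y))
      (FMap (Lft S) (under X) (under Y) f)"
  using next_obj(2) by (auto simp: arrows_iff Hom_full adj_category_def comp_functor_def)

lemma next_under_arrow: "f \<in> X \<rightarrow>\<^bsub>C'\<^esub> Y \<Longrightarrow> f \<in> under X \<rightarrow>\<^bsub>Cat S\<^esub> under Y"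
  by (simp add: next_arrow_iff)

lemma next_Cmp: "Cmp C' = Cmp B"
  by (simp add: Cmp_same adj_category_def Cmp_Cat)

lemma next_Ident: "X \<in> Obj C' \<Longrightarrow> Ident C' X = Ident B (base X)"
  using next_obj(2,4) by (simp add: Ident_same adj_category_def Ident_Cat)

lemma next_category: "category C'"
proof -
  have RLf: "FMap R (FObj (Lft S) V) (FObj (Lft S) W) (FMap (Lft S) V W f)
      \<in> FObj R (FObj (Lft S) V) \<rightarrow>\<^bsub>B\<^esub> FObj R (FObj (Lft S) W)"
    if "f \<in> V \<rightarrow>\<^bsub>Cat S\<^esub> W" for f V W
    by (rule base.R.fmap_arrow[OF L.fmap_arrow[OF that]])
  have ident: "Ident C' X \<in> X \<rightarrow>\<^bsub>C'\<^esub> X" if X: "X \<in> Obj C'" for X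
  proof -
    let ?V = "under X"
    note V = next_obj(2)[OF X] and b = next_obj(3)[OF X]
    have I: "Ident C' X = Ident (Cat S) ?V" by (simp add: Ident_same adj_category_def)
    have "Ident B (base X) \<cdot>\<^bsub>B\<^esub> str X = str X \<cdot>\<^bsub>B\<^esub> FMap R (FObj (Lft S) ?V) (FObj (Lft S) ?V)
        (FMap (Lft S) ?V ?V (Ident (Cat S) ?V))"
      using base.L.C.ident_left[OF b] base.L.C.ident_right[OF b] L.fmap_ident[OF V]
        base.R.fmap_ident[OF L.fobj_in_obj[OF V]] by simp
    then show ?thesis
      using X L.C.ident_arrow[OF V] I next_Ident[OF X] by (simp add: next_arrow_iff)
  qed
  have cmp: "g \<cdot>\<^bsub>B\<^esub> f \<in> X \<rightarrow>\<^bsub>C'\<^esub> Z" if f: "f \<in> X \<rightarrow>\<^bsub>C'\<^esub> Y" and g: "g \<in> Y \<rightarrow>\<^bsub>C'\<^esub> Z" for X Y Z f g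
  proof -
    have X: "X \<in> Obj C'" and Y: "Y \<in> Obj C'" and Z: "Z \<in> Obj C'" using f g by (auto simp: arrows_iff)
    note fu = next_under_arrow[OF f] and gu = next_under_arrow[OF g]
    note fB = base_arrow[OF fu] and gB = base_arrow[OF gu]
    note b = next_obj(3)[OF X, unfolded next_obj(4)[OF X]]
      and b' = next_obj(3)[OF Y, unfolded next_obj(4)[OF Y]]
      and b'' = next_obj(3)[OF Z, unfolded next_obj(4)[OF Z]]
    let ?F = "FMap R (FObj (Lft S) (under X)) (FObj (Lft S) (under Y)) (FMap (Lft S) (under X) (under Y) f)"
    let ?G = "FMap R (FObj (Lft S) (under Y)) (FObj (Lft S) (under Z)) (FMap (Lft S) (under Y) (under Z) g)"
    have "(g \<cdot>\<^bsub>B\<^esub> f) \<cdot>\<^bsub>B\<^esub> str X = g \<cdot>\<^bsub>B\<^esub> (str Y \<cdot>\<^bsub>B\<^esub> ?F)"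
      using base.L.C.assoc[OF b fB gB] f by (simp add: next_arrow_iff)
    also have "\<dots> = (str Z \<cdot>\<^bsub>B\<^esub> ?G) \<cdot>\<^bsub>B\<^esub> ?F"
      using base.L.C.assoc[OF RLf[OF fu] b' gB] g by (simp add: next_arrow_iff)
    also have "\<dots> = str Z \<cdot>\<^bsub>B\<^esub> FMap R (FObj (Lft S) (under X)) (FObj (Lft S) (under Z))
        (FMap (Lft S) (under X) (under Z) (g \<cdot>\<^bsub>B\<^esub> f))"
      using base.L.C.assoc[OF RLf[OF fu] RLf[OF gu] b''] L.fmap_comp[OF fu gu]
        base.R.fmap_comp[OF L.fmap_arrow[OF fu] L.fmap_arrow[OF gu]] by (simp add: Cmp_Cat)
    finally show ?thesis
      using X Z stage_cmp_arrow[OF fu gu] by (simp add: next_arrow_iff)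
  qed
  show ?thesis
  proof
    fix X assume "X \<in> Obj C'"
    then show "Ident C' X \<in> Hom C' X X" using ident by (simp add: arrows_iff)
  next
    fix X Y Z f g
    assume "X \<in> Obj C'" "Y \<in> Obj C'" "Z \<in> Obj C'" "f \<in> Hom C' X Y" "g \<in> Hom C' Y Z"
    then show "g \<cdot>\<^bsub>C'\<^esub> f \<in> Hom C' X Z" using cmp[of f X Y g Z] by (simp add: next_Cmp arrows_iff)
  next
    fix X Y f assume "X \<in> Obj C'" "Y \<in> Obj C'" "f \<in> Hom C' X Y"
    then have "f \<in> under X \<rightarrow>\<^bsub>Cat S\<^esub> under Y" by (intro next_under_arrow) (simp add: arrows_iff)
    then show "Ident C' Y \<cdot>\<^bsub>C'\<^esub> f = f" "f \<cdot>\<^bsub>C'\<^esub> Ident C' X = f"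
      using L.C.ident_left L.C.ident_right by (simp_all add: Ident_same Cmp_same adj_category_def)
  next
    fix W X Y Z f g h
    assume "W \<in> Obj C'" "X \<in> Obj C'" "Y \<in> Obj C'" "Z \<in> Obj C'"
      "f \<in> Hom C' W X" "g \<in> Hom C' X Y" "h \<in> Hom C' Y Z"
    then have "f \<in> under W \<rightarrow>\<^bsub>Cat S\<^esub> under X" "g \<in> under X \<rightarrow>\<^bsub>Cat S\<^esub> under Y" "h \<in> under Y \<rightarrow>\<^bsub>Cat S\<^esub> under Z"
      by (blast intro: next_under_arrow arrows_iff[THEN iffD2])+
    then show "(h \<cdot>\<^bsub>C'\<^esub> g) \<cdot>\<^bsub>C'\<^esub> f = h \<cdot>\<^bsub>C'\<^esub> (g \<cdot>\<^bsub>C'\<^esub> f)"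
      using stage_assoc by (simp add: next_Cmp)
  qed
qed

abbreviation "S' \<equiv> next_stage A S C' r c"

lemma next_stage_simps:
  "Cat S' = C'"
  "FObj (Lft S') X = fst (c X)"
  "FMap (Lft S') X Y f = (THE k. k \<in> Hom A (fst (c X)) (fst (c Y)) \<and>
     k \<cdot>\<^bsub>A\<^esub> snd (c X) = snd (c Y) \<cdot>\<^bsub>A\<^esub> FMap (Lft S) (under X) (under Y) f)"
  "FObj (Rgt S') Z = Ext (FObj (Rgt S) Z) (r Z)"
  "FMap (Rgt S') = FMap R"
  "Unit S' X = FMap R (FObj (Lft S) (under X)) (fst (c X)) (snd (c X)) \<cdot>\<^bsub>B\<^esub> Unit S (under X)"
  "Counit S' Z = (THE e. e \<in> Hom A (fst (c (Ext (FObj (Rgt S) Z) (r Z)))) Z \<and>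
     e \<cdot>\<^bsub>A\<^esub> snd (c (Ext (FObj (Rgt S) Z) (r Z))) = Counit S Z)"
  "Proj S' X = snd (c X) \<cdot>\<^bsub>A\<^esub> Proj S (under X)"
  by (simp_all add: next_stage_def Let_def FMap_Rgt Cmp_Cat)

lemma coeq_arrow: "X \<in> Obj C' \<Longrightarrow> snd (c X) \<in> FObj (Lft S) (under X) \<rightarrow>\<^bsub>A\<^esub> fst (c X)"
  using coeq next_obj(2) L.fobj_in_obj by (auto simp: is_coequalizer_def arrows_iff)

lemma coeq_factor:
  assumes "X \<in> Obj C'" "h \<in> FObj (Lft S) (under X) \<rightarrow>\<^bsub>A\<^esub> Y" "h \<cdot>\<^bsub>A\<^esub> s X = h \<cdot>\<^bsub>A\<^esub> t X"
  shows "\<exists>!k. k \<in> Hom A (fst (c X)) Y \<and> k \<cdot>\<^bsub>A\<^esub> snd (c X) = h"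
  using coeq[OF assms(1)] assms(2,3) unfolding is_coequalizer_def arrows_iff by blast

text \<open>
  The universal property of the next unit in terms of the old one: arrows from \<open>X\<close> to the new right
  adjoint at \<open>Y\<close> are the cotransposes of the arrows that coequalize the pair, which in turn
  are the arrows out of the coequalizer.
\<close>

lemma coequalizes_iff_arrow:
  assumes X: "X \<in> Obj C'" and h: "h \<in> FObj (Lft S) (under X) \<rightarrow>\<^bsub>A\<^esub> Y"
  shows "h \<cdot>\<^bsub>A\<^esub> s X = h \<cdot>\<^bsub>A\<^esub> t X \<longleftrightarrow>
    FMap R (FObj (Lft S) (under X)) Y h \<cdot>\<^bsub>B\<^esub> Unit S (under X) \<in> X \<rightarrow>\<^bsub>C'\<^esub> Ext (FObj (Rgt S) Y) (r Y)"
proof -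
  let ?V = "under X" and ?RY = "FObj (Rgt S) Y"
  let ?g = "FMap R (FObj (Lft S) ?V) Y h \<cdot>\<^bsub>B\<^esub> Unit S ?V"
  have Y: "Y \<in> Obj A" using h by (rule arrows_cod)
  note V = next_obj(2)[OF X]
  have g: "?g \<in> ?V \<rightarrow>\<^bsub>Cat S\<^esub> ?RY" by (rule stage_cotranspose_arrow[OF V h])
  have "FMap R (FObj (Lft S) ?V) Y h
      = r Y \<cdot>\<^bsub>B\<^esub> FMap R (FObj (Lft S) ?V) (FObj (Lft S) ?RY) (FMap (Lft S) ?V ?RY ?g)"
    using stage_transpose_cotranspose[OF V h]
      base.R.fmap_comp[OF L.fmap_arrow[OF g] counit_arrow[OF Y]] by (simp add: r_eq)
  then show ?thesis
    using coequalizes_iff[OF X h] g X Rgt_in_Obj[OF Y] by (simp add: next_arrow_iff)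
qed

lemma coeq_commutes: "X \<in> Obj C' \<Longrightarrow> snd (c X) \<cdot>\<^bsub>A\<^esub> s X = snd (c X) \<cdot>\<^bsub>A\<^esub> t X"
  using coeq by (simp add: is_coequalizer_def)

lemma coeq_epi:
  assumes X: "X \<in> Obj C'" and k: "k \<in> fst (c X) \<rightarrow>\<^bsub>A\<^esub> Y" "k' \<in> fst (c X) \<rightarrow>\<^bsub>A\<^esub> Y"
    and eq: "k \<cdot>\<^bsub>A\<^esub> snd (c X) = k' \<cdot>\<^bsub>A\<^esub> snd (c X)"
  shows "k = k'"
proof -
  note p = coeq_arrow[OF X]
  have "(k \<cdot>\<^bsub>A\<^esub> snd (c X)) \<cdot>\<^bsub>A\<^esub> s X = (k \<cdot>\<^bsub>A\<^esub> snd (c X)) \<cdot>\<^bsub>A\<^esub> t X"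
    using base.L.D.assoc[OF _ p k(1)] pair_arrow[OF X] coeq_commutes[OF X] by metis
  from coeq_factor[OF X base.L.D.cmp_arrow[OF p k(1)] this] k eq show ?thesis
    by (auto simp: arrows_iff)
qed

lemma next_unit_arrow: "X \<in> Obj C' \<Longrightarrow> Unit S' X \<in> X \<rightarrow>\<^bsub>C'\<^esub> FObj (Rgt S') (FObj (Lft S') X)"
  using coequalizes_iff_arrow[OF _ coeq_arrow] coeq_commutes by (simp add: next_stage_simps)

text \<open>Cotransposing at the next stage is precomposing with the coequalizer and cotransposing at the old one.\<close>

lemma cmp_next_unit:
  assumes X: "X \<in> Obj C'" and k: "k \<in> fst (c X) \<rightarrow>\<^bsub>A\<^esub> Y"
  shows "FMap R (fst (c X)) Y k \<cdot>\<^bsub>B\<^esub> Unit S' X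
    = FMap R (FObj (Lft S) (under X)) Y (k \<cdot>\<^bsub>A\<^esub> snd (c X)) \<cdot>\<^bsub>B\<^esub> Unit S (under X)"
  using stage_assoc[OF unit_arrow[OF next_obj(2)[OF X]] stage_Rgt_arrow[OF coeq_arrow[OF X]] stage_Rgt_arrow[OF k]]
    base.R.fmap_comp[OF coeq_arrow[OF X] k] by (simp add: next_stage_simps)

text \<open>
  The cotranspose of the arrow to be factored is the next unit at \<open>Y\<close> composed with \<open>f\<close>, an arrow of
  \<open>C'\<close>; so the arrow coequalizes the pair, and the definite description in the action of the next
  left adjoint on arrows denotes.
\<close>

lemma next_Lft:
  assumes f: "f \<in> X \<rightarrow>\<^bsub>C'\<^esub> Y"
  shows "FMap (Lft S') X Y f \<in> fst (c X) \<rightarrow>\<^bsub>A\<^esub> fst (c Y)"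
    and "FMap (Lft S') X Y f \<cdot>\<^bsub>A\<^esub> snd (c X) = snd (c Y) \<cdot>\<^bsub>A\<^esub> FMap (Lft S) (under X) (under Y) f"
proof -
  have X: "X \<in> Obj C'" and Y: "Y \<in> Obj C'" using f by (auto simp: arrows_iff)
  note fu = next_under_arrow[OF f] and V = next_obj(2)[OF X] and W = next_obj(2)[OF Y]
  let ?h = "snd (c Y) \<cdot>\<^bsub>A\<^esub> FMap (Lft S) (under X) (under Y) f"
  have h: "?h \<in> FObj (Lft S) (under X) \<rightarrow>\<^bsub>A\<^esub> fst (c Y)"
    by (rule base.L.D.cmp_arrow[OF L.fmap_arrow[OF fu] coeq_arrow[OF Y]])
  have "FMap R (FObj (Lft S) (under X)) (fst (c Y)) ?h \<cdot>\<^bsub>B\<^esub> Unit S (under X) = Unit S' Y \<cdot>\<^bsub>B\<^esub> f"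
    using base.R.fmap_comp[OF L.fmap_arrow[OF fu] coeq_arrow[OF Y]] stage_unit_natural[OF fu]
      stage_assoc[OF unit_arrow[OF V] stage_Rgt_arrow[OF L.fmap_arrow[OF fu]] stage_Rgt_arrow[OF coeq_arrow[OF Y]]]
      stage_assoc[OF fu unit_arrow[OF W] stage_Rgt_arrow[OF coeq_arrow[OF Y]]]
    by (simp add: next_stage_simps)
  also have "\<dots> \<in> X \<rightarrow>\<^bsub>C'\<^esub> Ext (FObj (Rgt S) (fst (c Y))) (r (fst (c Y)))"
    using category.cmp_arrow[OF next_category f next_unit_arrow[OF Y]] by (simp add: next_Cmp next_stage_simps(2,4))
  finally have "?h \<cdot>\<^bsub>A\<^esub> s X = ?h \<cdot>\<^bsub>A\<^esub> t X" using coequalizes_iff_arrow[OF X h] by simp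
  from theI'[OF coeq_factor[OF X h this]]
  show "FMap (Lft S') X Y f \<in> fst (c X) \<rightarrow>\<^bsub>A\<^esub> fst (c Y)"
    and "FMap (Lft S') X Y f \<cdot>\<^bsub>A\<^esub> snd (c X) = ?h"
    using coeq_arrow[OF X] coeq_arrow[OF Y] by (auto simp: next_stage_simps arrows_iff)
qed

lemma next_Rgt_functor: "cat_functor A C' (Rgt S')"
proof -
  have arr: "FMap R Y Z h \<in> FObj (Rgt S') Y \<rightarrow>\<^bsub>C'\<^esub> FObj (Rgt S') Z" if h: "h \<in> Y \<rightarrow>\<^bsub>A\<^esub> Z" for Y Z h
  proof -
    have Y: "Y \<in> Obj A" and Z: "Z \<in> Obj A" using h by (auto simp: arrows_iff)
    note Rh = stage_Rgt_arrow[OF h]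
    show ?thesis
      using stage_counit_natural[OF h] base.R.fmap_comp[OF counit_arrow[OF Y] h] Rh
        base.R.fmap_comp[OF L.fmap_arrow[OF Rh] counit_arrow[OF Z]] Rgt_in_Obj[OF Y] Rgt_in_Obj[OF Z]
      by (simp add: next_arrow_iff next_stage_simps r_eq)
  qed
  interpret C': category C' by (rule next_category)
  show ?thesis
    by unfold_locales
      (use arr Rgt_in_Obj base.R.fmap_ident base.R.fmap_cmp in
        \<open>auto simp: arrows_iff next_stage_simps(4,5) next_Ident next_Cmp base_Rgt\<close>)
qed

text \<open>
  The cotranspose of the old counit is an identity by a triangle, hence an arrow of \<open>C'\<close>; so the old
  counit factors through the coequalizer.
\<close>

lemma next_Counit:
  assumes Y: "Y \<in> Obj A"
  shows "Counit S' Y \<in> FObj (Lft S') (FObj (Rgt S') Y) \<rightarrow>\<^bsub>A\<^esub> Y"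
    and "Counit S' Y \<cdot>\<^bsub>A\<^esub> snd (c (FObj (Rgt S') Y)) = Counit S Y"
proof -
  let ?X = "Ext (FObj (Rgt S) Y) (r Y)"
  have X: "?X \<in> Obj C'" by (rule Rgt_in_Obj[OF Y])
  have e: "Counit S Y \<in> FObj (Lft S) (under ?X) \<rightarrow>\<^bsub>A\<^esub> Y" using counit_arrow[OF Y] by simp
  have "Ident B (FObj R Y) \<in> ?X \<rightarrow>\<^bsub>C'\<^esub> ?X"
    using category.ident_arrow[OF next_category X] next_Ident[OF X] by (simp add: base_Rgt)
  then have "Counit S Y \<cdot>\<^bsub>A\<^esub> s ?X = Counit S Y \<cdot>\<^bsub>A\<^esub> t ?X"
    using coequalizes_iff_arrow[OF X e] stage_triangle[OF Y] by simp
  from theI'[OF coeq_factor[OF X e this]]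
  show "Counit S' Y \<in> FObj (Lft S') (FObj (Rgt S') Y) \<rightarrow>\<^bsub>A\<^esub> Y"
    and "Counit S' Y \<cdot>\<^bsub>A\<^esub> snd (c (FObj (Rgt S') Y)) = Counit S Y"
    using coeq_arrow[OF X] Y by (auto simp: next_stage_simps arrows_iff)
qed

lemma next_adjunction: "adjunction A C' (Lft S') (Rgt S') (Unit S') (Counit S')"
proof (rule adjunction_from_universal_arrows[OF next_category next_Rgt_functor];
    (unfold next_Cmp next_stage_simps(2,5))?)
  show "fst (c X) \<in> Obj A" if "X \<in> Obj C'" for X
    using arrows_cod[OF coeq_arrow[OF that]] .
  show "Unit S' X \<in> X \<rightarrow>\<^bsub>C'\<^esub> FObj (Rgt S') (fst (c X))" if "X \<in> Obj C'" for X
    using next_unit_arrow[OF that] by (simp add: next_stage_simps(2))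
  show "h = h'" if X: "X \<in> Obj C'" and h: "h \<in> fst (c X) \<rightarrow>\<^bsub>A\<^esub> Y" and h': "h' \<in> fst (c X) \<rightarrow>\<^bsub>A\<^esub> Y"
    and eq: "FMap R (fst (c X)) Y h \<cdot>\<^bsub>B\<^esub> Unit S' X = FMap R (fst (c X)) Y h' \<cdot>\<^bsub>B\<^esub> Unit S' X" for X Y h h'
  proof (rule coeq_epi[OF X h h'])
    show "h \<cdot>\<^bsub>A\<^esub> snd (c X) = h' \<cdot>\<^bsub>A\<^esub> snd (c X)"
      by (rule stage_cotranspose_inject[OF next_obj(2)[OF X]])
        (use cmp_next_unit[OF X h] cmp_next_unit[OF X h'] eq base.L.D.cmp_arrow[OF coeq_arrow[OF X]] h h' in auto)
  qed
  show "FMap (Lft S') X Y f \<in> fst (c X) \<rightarrow>\<^bsub>A\<^esub> fst (c Y)" if "f \<in> X \<rightarrow>\<^bsub>C'\<^esub> Y" for X Y f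
    by (rule next_Lft(1)[OF that])
  show "FMap R (fst (c X)) (fst (c Y)) (FMap (Lft S') X Y f) \<cdot>\<^bsub>B\<^esub> Unit S' X = Unit S' Y \<cdot>\<^bsub>B\<^esub> f"
    if f: "f \<in> X \<rightarrow>\<^bsub>C'\<^esub> Y" for X Y f
  proof -
    have X: "X \<in> Obj C'" and Y: "Y \<in> Obj C'" using f by (auto simp: arrows_iff)
    note fu = next_under_arrow[OF f] and V = next_obj(2)[OF X] and W = next_obj(2)[OF Y]
    show ?thesis
      using cmp_next_unit[OF X next_Lft(1)[OF f]] next_Lft(2)[OF f]
        base.R.fmap_comp[OF L.fmap_arrow[OF fu] coeq_arrow[OF Y]] stage_unit_natural[OF fu]
        stage_assoc[OF unit_arrow[OF V] stage_Rgt_arrow[OF L.fmap_arrow[OF fu]] stage_Rgt_arrow[OF coeq_arrow[OF Y]]]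
        stage_assoc[OF fu unit_arrow[OF W] stage_Rgt_arrow[OF coeq_arrow[OF Y]]]
      by (simp add: next_stage_simps(6))
  qed
  show "Counit S' Y \<in> fst (c (FObj (Rgt S') Y)) \<rightarrow>\<^bsub>A\<^esub> Y" if "Y \<in> Obj A" for Y
    using next_Counit(1)[OF that] by (simp add: next_stage_simps(2))
  show "FMap R (fst (c (FObj (Rgt S') Y))) Y (Counit S' Y) \<cdot>\<^bsub>B\<^esub> Unit S' (FObj (Rgt S') Y)
      = Ident C' (FObj (Rgt S') Y)" if Y: "Y \<in> Obj A" for Y
  proof -
    have X: "FObj (Rgt S') Y \<in> Obj C'" using Rgt_in_Obj[OF Y] by (simp add: next_stage_simps(4))
    have e: "Counit S' Y \<in> fst (c (FObj (Rgt S') Y)) \<rightarrow>\<^bsub>A\<^esub> Y"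
      using next_Counit(1)[OF Y] by (simp add: next_stage_simps(2))
    show ?thesis
      using cmp_next_unit[OF X e] next_Counit(2)[OF Y] stage_triangle[OF Y] next_Ident[OF X]
      by (simp add: next_stage_simps(4) base_Rgt)
  qed
qed

lemma tower_stage_next: "tower_stage A B L R \<eta> \<epsilon> S'"
proof -
  interpret N: adjunction A "Cat S'" "Lft S'" "Rgt S'" "Unit S'" "Counit S'"
    using next_adjunction by (simp add: next_stage_simps(1))
  show ?thesis
  proof (unfold_locales, unfold next_stage_simps(1,2,5) next_Cmp)
    show "base V \<in> Obj B" if "V \<in> Obj C'" for V
      using base_in_obj next_obj(2,4)[OF that] by simp
    show "Hom C' V W \<subseteq> Hom B (base V) (base W)" if "V \<in> Obj C'" "W \<in> Obj C'" for V W
      using hom_base[OF next_obj(2)[OF that(1)] next_obj(2)[OF that(2)]] next_obj(4) that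
      by (auto simp: Hom_full adj_category_def)
    show "Ident C' V = Ident B (base V)" if "V \<in> Obj C'" for V by (rule next_Ident[OF that])
    show "Cmp B = Cmp B" "FMap R = FMap R" by simp_all
    show "base (FObj (Rgt S') Y) = FObj R Y" for Y by (simp add: next_stage_simps base_Rgt)
    show "Proj S' X \<in> FObj L (base X) \<rightarrow>\<^bsub>A\<^esub> fst (c X)" if X: "X \<in> Obj C'" for X
      using base.L.D.cmp_arrow[OF Proj_arrow[OF next_obj(2)[OF X]] coeq_arrow[OF X]] next_obj(4)[OF X]
      by (simp add: next_stage_simps)
    show "FMap (Lft S') X Y f \<cdot>\<^bsub>A\<^esub> Proj S' X = Proj S' Y \<cdot>\<^bsub>A\<^esub> FMap L (base X) (base Y) f"
      if f: "f \<in> X \<rightarrow>\<^bsub>C'\<^esub> Y" for X Y f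
    proof -
      have X: "X \<in> Obj C'" and Y: "Y \<in> Obj C'" using f by (auto simp: arrows_iff)
      note fu = next_under_arrow[OF f] and V = next_obj(2)[OF X] and W = next_obj(2)[OF Y]
      show ?thesis
        using base.L.D.assoc[OF Proj_arrow[OF V] coeq_arrow[OF X] next_Lft(1)[OF f]] next_Lft(2)[OF f]
          base.L.D.assoc[OF Proj_arrow[OF V] L.fmap_arrow[OF fu] coeq_arrow[OF Y]] Proj_natural[OF fu]
          base.L.D.assoc[OF base.L.fmap_arrow[OF base_arrow[OF fu]] Proj_arrow[OF W] coeq_arrow[OF Y]]
          next_obj(4)[OF X] next_obj(4)[OF Y]
        by (simp add: next_stage_simps(8))
    qed
    show "Counit S' Y \<cdot>\<^bsub>A\<^esub> Proj S' (FObj (Rgt S') Y) = \<epsilon> Y" if Y: "Y \<in> Obj A" for Y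
    proof -
      let ?X = "FObj (Rgt S') Y"
      have X: "?X \<in> Obj C'" and V: "under ?X = FObj (Rgt S) Y"
        using Rgt_in_Obj[OF Y] by (simp_all add: next_stage_simps(4))
      show ?thesis
        using base.L.D.assoc[OF Proj_arrow[OF next_obj(2)[OF X]] coeq_arrow[OF X]
            next_Counit(1)[OF Y, unfolded next_stage_simps(2)]]
          next_Counit(2)[OF Y] Counit_Proj[OF Y] V by (simp add: next_stage_simps(8))
    qed
  qed
qed

end

section \<open>The two towers\<close>

lemma (in tower_stage) adj_next:
  assumes "chosen_coequalizers A cq"
  shows "next_tower_stage A B L R \<eta> \<epsilon> S (adj_category B R S)
      (\<lambda>Y. FMap R (FObj (Lft S) (FObj (Rgt S) Y)) Y (Counit S Y)) (adj_coeq A cq L R \<epsilon> S)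
      (\<lambda>X. FObj L (FObj R (FObj (Lft S) (under X))))
      (\<lambda>X. Proj S (under X) \<cdot>\<^bsub>A\<^esub> FMap L (FObj R (FObj (Lft S) (under X))) (base (under X)) (str X))
      (\<lambda>X. \<epsilon> (FObj (Lft S) (under X)))"
proof -
  have obj: "under X \<in> Obj (Cat S)" "str X \<in> FObj R (FObj (Lft S) (under X)) \<rightarrow>\<^bsub>B\<^esub> base (under X)"
    if "X \<in> Obj (adj_category B R S)" for X
    using that by (auto simp: adj_category_def arrows_iff base_in_obj L.fobj_in_obj base.R.fobj_in_obj)
  have pair: "Proj S (under X) \<cdot>\<^bsub>A\<^esub> FMap L (FObj R (FObj (Lft S) (under X))) (base (under X)) (str X)
        \<in> FObj L (FObj R (FObj (Lft S) (under X))) \<rightarrow>\<^bsub>A\<^esub> FObj (Lft S) (under X)"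
      "\<epsilon> (FObj (Lft S) (under X)) \<in> FObj L (FObj R (FObj (Lft S) (under X))) \<rightarrow>\<^bsub>A\<^esub> FObj (Lft S) (under X)"
    if "X \<in> Obj (adj_category B R S)" for X
    using base.L.D.cmp_arrow[OF base.L.fmap_arrow[OF obj(2)] Proj_arrow[OF obj(1)]] that
      base.counit_arrow[OF L.fobj_in_obj[OF obj(1)]] by blast+
  show ?thesis
  proof
    show "Ext (FObj (Rgt S) Y) (FMap R (FObj (Lft S) (FObj (Rgt S) Y)) Y (Counit S Y))
        \<in> Obj (adj_category B R S)" if "Y \<in> Obj A" for Y
      using that base_arrow[OF stage_Rgt_arrow[OF counit_arrow]] R.fobj_in_obj
      by (auto simp: adj_category_def base_Rgt arrows_iff)
    show "is_coequalizer A (FObj L (FObj R (FObj (Lft S) (under X)))) (FObj (Lft S) (under X))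
        (Proj S (under X) \<cdot>\<^bsub>A\<^esub> FMap L (FObj R (FObj (Lft S) (under X))) (base (under X)) (str X))
        (\<epsilon> (FObj (Lft S) (under X))) (fst (adj_coeq A cq L R \<epsilon> S X)) (snd (adj_coeq A cq L R \<epsilon> S X))"
      if "X \<in> Obj (adj_category B R S)" for X
      using that assms pair by (simp add: chosen_coequalizers_def adj_coeq_def Let_def arrows_iff)
  qed (use pair adj_coequalizes_iff obj in auto)
qed

lemma (in tower_stage) monadic_category_obj_iff: "Ext V \<mu> \<in> Obj (monadic_category S) \<longleftrightarrow>
  (let M = FObj (Lft S) V in
    V \<in> Obj (Cat S) \<and> \<mu> \<in> FObj (Rgt S) M \<rightarrow>\<^bsub>Cat S\<^esub> V \<and> \<mu> \<cdot>\<^bsub>B\<^esub> Unit S V = Ident B (base V) \<and>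
    \<mu> \<cdot>\<^bsub>B\<^esub> FMap R (FObj (Lft S) (FObj (Rgt S) M)) M (FMap (Lft S) (FObj (Rgt S) M) V \<mu>)
      = \<mu> \<cdot>\<^bsub>B\<^esub> FMap R (FObj (Lft S) (FObj (Rgt S) M)) M (Counit S M))"
  by (auto simp: monadic_category_def eilenberg_moore_def is_algebra_def Let_def comp_functor_def
      arrows_iff Ident_Cat Cmp_Cat FMap_Rgt L.fobj_in_obj R.fobj_in_obj)

lemma (in tower_stage) monadic_next:
  assumes "chosen_coequalizers A cq"
  shows "next_tower_stage A B L R \<eta> \<epsilon> S (monadic_category S)
      (\<lambda>Y. FMap (Rgt S) (FObj (Lft S) (FObj (Rgt S) Y)) Y (Counit S Y)) (monadic_coeq cq S)
      (\<lambda>X. FObj (Lft S) (FObj (Rgt S) (FObj (Lft S) (under X))))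
      (\<lambda>X. FMap (Lft S) (FObj (Rgt S) (FObj (Lft S) (under X))) (under X) (str X))
      (\<lambda>X. Counit S (FObj (Lft S) (under X)))"
proof -
  have obj: "under X \<in> Obj (Cat S)" "str X \<in> FObj (Rgt S) (FObj (Lft S) (under X)) \<rightarrow>\<^bsub>Cat S\<^esub> under X"
    "X = Ext (under X) (str X)"
    if "X \<in> Obj (monadic_category S)" for X
    using that monadic_category_obj_iff[of "under X" "str X"]
    by (auto simp: monadic_category_def eilenberg_moore_def is_algebra_def Let_def)
  show ?thesis
  proof
    show "Obj (monadic_category S) \<subseteq> Obj (adj_category B R S)"
    proof
      fix X assume X: "X \<in> Obj (monadic_category S)"
      show "X \<in> Obj (adj_category B R S)"
        using obj(1)[OF X] base_arrow[OF obj(2)[OF X]] obj(3)[OF X]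
        by (simp add: adj_category_def base_Rgt arrows_iff) metis
    qed
    show "Ext (FObj (Rgt S) Y) (FMap (Rgt S) (FObj (Lft S) (FObj (Rgt S) Y)) Y (Counit S Y))
        \<in> Obj (monadic_category S)" if Y: "Y \<in> Obj A" for Y
    proof -
      note e = counit_arrow[OF Y]
      note LRe = L.fmap_arrow[OF stage_Rgt_arrow[OF e]]
      \<comment> \<open>Unit law: a triangle.  Associativity: \<open>R\<close> applied to naturality of the counit at the counit.\<close>
      show ?thesis
        using R.fobj_in_obj[OF Y] stage_Rgt_arrow[OF e] stage_triangle[OF Y]
          stage_counit_natural[OF e] base.R.fmap_comp[OF LRe e]
          base.R.fmap_comp[OF counit_arrow[OF arrows_dom[OF e]] e]
        by (simp add: monadic_category_obj_iff base_Rgt Let_def FMap_Rgt)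
    qed
    fix X assume X: "X \<in> Obj (monadic_category S)"
    let ?M = "FObj (Lft S) (under X)"
    show \<mu>: "FMap (Lft S) (FObj (Rgt S) ?M) (under X) (str X) \<in> FObj (Lft S) (FObj (Rgt S) ?M) \<rightarrow>\<^bsub>A\<^esub> ?M"
      by (rule L.fmap_arrow[OF obj(2)[OF X]])
    show c: "Counit S ?M \<in> FObj (Lft S) (FObj (Rgt S) ?M) \<rightarrow>\<^bsub>A\<^esub> ?M"
      by (rule counit_arrow[OF L.fobj_in_obj[OF obj(1)[OF X]]])
    show "is_coequalizer A (FObj (Lft S) (FObj (Rgt S) ?M)) ?M
        (FMap (Lft S) (FObj (Rgt S) ?M) (under X) (str X)) (Counit S ?M)
        (fst (monadic_coeq cq S X)) (snd (monadic_coeq cq S X))"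
      using assms \<mu> c by (simp add: chosen_coequalizers_def monadic_coeq_def Let_def arrows_iff)
    show "h \<cdot>\<^bsub>A\<^esub> FMap (Lft S) (FObj (Rgt S) ?M) (under X) (str X) = h \<cdot>\<^bsub>A\<^esub> Counit S ?M \<longleftrightarrow>
        (FMap R ?M Y h \<cdot>\<^bsub>B\<^esub> Unit S (under X)) \<cdot>\<^bsub>B\<^esub> str X = FMap R ?M Y h"
      if "h \<in> ?M \<rightarrow>\<^bsub>A\<^esub> Y" for Y h
      by (rule monadic_coequalizes_iff[OF obj(1,2)[OF X] that])
  qed (simp_all add: monadic_category_def eilenberg_moore_def adj_category_def FMap_Rgt Cmp_Cat comp_functor_def)
qed

section \<open>The comparison functor\<close>

text \<open>
  The properties of the comparison functor that its recursion preserves.  It is the identity on arrows,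
  so \<open>Hom_\<Lambda>\<close> is full faithfulness.  \<open>\<Lambda>_replete\<close>, that the image is closed under isomorphism, has to be part of the
  induction: its instance for the underlying objects is needed before structures can be transported.
\<close>

locale comparison_stage =
  T: tower_stage A B L R \<eta> \<epsilon> T +
  S: tower_stage A B L R \<eta> \<epsilon> S
  for A :: "('p, 'n) category_data" and B :: "('o, 'm) category_data"
    and L :: "('o, 'm, 'p, 'n) functor_data" and R :: "('p, 'n, 'o, 'm) functor_data"
    and \<eta> :: "'o \<Rightarrow> 'm" and \<epsilon> :: "'p \<Rightarrow> 'n"
    and T :: "('o, 'm, 'p, 'n) stage" and S :: "('o, 'm, 'p, 'n) stage" +
  fixes \<Lambda> :: "(('o, 'm) tower_obj, 'm, ('o, 'm) tower_obj, 'm) functor_data"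
  assumes FMap_\<Lambda>: "FMap \<Lambda> V W f = f"
    and \<Lambda>_obj: "V \<in> Obj (Cat T) \<Longrightarrow> FObj \<Lambda> V \<in> Obj (Cat S)"
    and base_\<Lambda>: "V \<in> Obj (Cat T) \<Longrightarrow> base (FObj \<Lambda> V) = base V"
    and Hom_\<Lambda>: "V \<in> Obj (Cat T) \<Longrightarrow> W \<in> Obj (Cat T) \<Longrightarrow>
      Hom (Cat S) (FObj \<Lambda> V) (FObj \<Lambda> W) = Hom (Cat T) V W"
    and inj_\<Lambda>: "inj_on (FObj \<Lambda>) (Obj (Cat T))"
    and \<Lambda>_Rgt: "Y \<in> Obj A \<Longrightarrow> FObj \<Lambda> (FObj (Rgt T) Y) = FObj (Rgt S) Y"
    and \<Lambda>_replete: "V \<in> Obj (Cat T) \<Longrightarrow> f \<in> FObj \<Lambda> V \<rightarrow>\<^bsub>Cat S\<^esub> X \<Longrightarrow> g \<in> X \<rightarrow>\<^bsub>Cat S\<^esub> FObj \<Lambda> V \<Longrightarrow>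
      g \<cdot>\<^bsub>B\<^esub> f = Ident B (base V) \<Longrightarrow> f \<cdot>\<^bsub>B\<^esub> g = Ident B (base X) \<Longrightarrow> X \<in> FObj \<Lambda> ` Obj (Cat T)"
begin

lemma \<Lambda>_arrow_iff: "V \<in> Obj (Cat T) \<Longrightarrow> W \<in> Obj (Cat T) \<Longrightarrow>
    f \<in> FObj \<Lambda> V \<rightarrow>\<^bsub>Cat S\<^esub> FObj \<Lambda> W \<longleftrightarrow> f \<in> V \<rightarrow>\<^bsub>Cat T\<^esub> W"
  by (simp add: arrows_iff Hom_\<Lambda> \<Lambda>_obj)

lemma \<Lambda>_arrow: "f \<in> V \<rightarrow>\<^bsub>Cat T\<^esub> W \<Longrightarrow> f \<in> FObj \<Lambda> V \<rightarrow>\<^bsub>Cat S\<^esub> FObj \<Lambda> W"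
  using \<Lambda>_arrow_iff arrows_dom arrows_cod by metis

abbreviation "comp_iso \<equiv> comparison_iso A T S \<Lambda>"

text \<open>
  The component at \<open>V\<close> is the transpose of the unit of \<open>T\<close>, seen as an arrow \<open>\<Lambda> V \<rightarrow> Rgt S (Lft T V)\<close>;
  \<open>comparison_iso_unit\<close> determines it, and all that follows uses only this.
\<close>

lemma comparison_iso_arrow: "V \<in> Obj (Cat T) \<Longrightarrow> comp_iso V \<in> FObj (Lft S) (FObj \<Lambda> V) \<rightarrow>\<^bsub>A\<^esub> FObj (Lft T) V"
  and comparison_iso_unit: "V \<in> Obj (Cat T) \<Longrightarrow>
    FMap R (FObj (Lft S) (FObj \<Lambda> V)) (FObj (Lft T) V) (comp_iso V) \<cdot>\<^bsub>B\<^esub> Unit S (FObj \<Lambda> V) = Unit T V"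
proof -
  assume V: "V \<in> Obj (Cat T)"
  note LV = T.L.fobj_in_obj[OF V]
  have u: "Unit T V \<in> FObj \<Lambda> V \<rightarrow>\<^bsub>Cat S\<^esub> FObj (Rgt S) (FObj (Lft T) V)"
    using \<Lambda>_arrow[OF T.unit_arrow[OF V]] \<Lambda>_Rgt[OF LV] by simp
  have "comp_iso V = Counit S (FObj (Lft T) V) \<cdot>\<^bsub>A\<^esub>
      FMap (Lft S) (FObj \<Lambda> V) (FObj (Rgt S) (FObj (Lft T) V)) (Unit T V)"
    by (simp add: comparison_iso_def comp_functor_def FMap_\<Lambda> \<Lambda>_Rgt[OF LV])
  then show "comp_iso V \<in> FObj (Lft S) (FObj \<Lambda> V) \<rightarrow>\<^bsub>A\<^esub> FObj (Lft T) V"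
    and "FMap R (FObj (Lft S) (FObj \<Lambda> V)) (FObj (Lft T) V) (comp_iso V) \<cdot>\<^bsub>B\<^esub> Unit S (FObj \<Lambda> V) = Unit T V"
    using S.transpose_arrow[OF u LV] S.stage_cotranspose_transpose[OF u LV] by simp_all
qed

lemma cmp_comparison_iso_unit:
  assumes V: "V \<in> Obj (Cat T)" and h: "h \<in> FObj (Lft T) V \<rightarrow>\<^bsub>A\<^esub> Y"
  shows "FMap R (FObj (Lft S) (FObj \<Lambda> V)) Y (h \<cdot>\<^bsub>A\<^esub> comp_iso V) \<cdot>\<^bsub>B\<^esub> Unit S (FObj \<Lambda> V)
    = FMap R (FObj (Lft T) V) Y h \<cdot>\<^bsub>B\<^esub> Unit T V"
  using T.base.R.fmap_comp[OF comparison_iso_arrow[OF V] h] comparison_iso_unit[OF V]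
    S.stage_assoc[OF S.unit_arrow[OF \<Lambda>_obj[OF V]] S.stage_Rgt_arrow[OF comparison_iso_arrow[OF V]]
      S.stage_Rgt_arrow[OF h]] by simp

lemma comparison_iso_natural:
  assumes f: "f \<in> V \<rightarrow>\<^bsub>Cat T\<^esub> W"
  shows "comp_iso W \<cdot>\<^bsub>A\<^esub> FMap (Lft S) (FObj \<Lambda> V) (FObj \<Lambda> W) f = FMap (Lft T) V W f \<cdot>\<^bsub>A\<^esub> comp_iso V"
proof -
  have V: "V \<in> Obj (Cat T)" and W: "W \<in> Obj (Cat T)" using f by (auto simp: arrows_iff)
  note Sf = \<Lambda>_arrow[OF f]
  note lV = comparison_iso_arrow[OF V] and lW = comparison_iso_arrow[OF W]
  show ?thesis
  proof (rule S.stage_cotranspose_inject[OF \<Lambda>_obj[OF V]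
        T.base.L.D.cmp_arrow[OF S.L.fmap_arrow[OF Sf] lW] T.base.L.D.cmp_arrow[OF lV T.L.fmap_arrow[OF f]]])
    let ?L = "FObj (Lft S) (FObj \<Lambda> V)"
    have "FMap R ?L (FObj (Lft T) W) (comp_iso W \<cdot>\<^bsub>A\<^esub> FMap (Lft S) (FObj \<Lambda> V) (FObj \<Lambda> W) f)
        \<cdot>\<^bsub>B\<^esub> Unit S (FObj \<Lambda> V) = Unit T W \<cdot>\<^bsub>B\<^esub> f"
      using T.base.R.fmap_comp[OF S.L.fmap_arrow[OF Sf] lW] S.stage_unit_natural[OF Sf] comparison_iso_unit[OF W]
        S.stage_assoc[OF S.unit_arrow[OF \<Lambda>_obj[OF V]] S.stage_Rgt_arrow[OF S.L.fmap_arrow[OF Sf]] S.stage_Rgt_arrow[OF lW]]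
        S.stage_assoc[OF Sf S.unit_arrow[OF \<Lambda>_obj[OF W]] S.stage_Rgt_arrow[OF lW]]
      by simp
    then show "FMap R ?L (FObj (Lft T) W) (comp_iso W \<cdot>\<^bsub>A\<^esub> FMap (Lft S) (FObj \<Lambda> V) (FObj \<Lambda> W) f)
        \<cdot>\<^bsub>B\<^esub> Unit S (FObj \<Lambda> V)
      = FMap R ?L (FObj (Lft T) W) (FMap (Lft T) V W f \<cdot>\<^bsub>A\<^esub> comp_iso V) \<cdot>\<^bsub>B\<^esub> Unit S (FObj \<Lambda> V)"
      using cmp_comparison_iso_unit[OF V T.L.fmap_arrow[OF f]] T.stage_unit_natural[OF f] by simp
  qed
qed

text \<open>
  Since \<open>\<Lambda>\<close> is full and \<open>\<Lambda> \<circ> Rgt T = Rgt S\<close>, the unit of \<open>S\<close> at \<open>\<Lambda> V\<close> is an arrow \<open>V \<rightarrow> Rgt T (Lft S (\<Lambda> V))\<close> of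
  \<open>Cat T\<close>.  The inverse is its transpose for \<open>T\<close>: both composites become identities when
  composed with the units.
\<close>

lemma comparison_iso_inverse:
  assumes V: "V \<in> Obj (Cat T)"
  obtains k where "k \<in> FObj (Lft T) V \<rightarrow>\<^bsub>A\<^esub> FObj (Lft S) (FObj \<Lambda> V)"
    and "k \<cdot>\<^bsub>A\<^esub> comp_iso V = Ident A (FObj (Lft S) (FObj \<Lambda> V))"
    and "comp_iso V \<cdot>\<^bsub>A\<^esub> k = Ident A (FObj (Lft T) V)"
proof -
  let ?M = "FObj (Lft S) (FObj \<Lambda> V)" and ?N = "FObj (Lft T) V"
  note \<Lambda>V = \<Lambda>_obj[OF V] and l = comparison_iso_arrow[OF V]
  have M: "?M \<in> Obj A" and N: "?N \<in> Obj A" using S.L.fobj_in_obj[OF \<Lambda>V] T.L.fobj_in_obj[OF V] by auto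
  have u: "Unit S (FObj \<Lambda> V) \<in> V \<rightarrow>\<^bsub>Cat T\<^esub> FObj (Rgt T) ?M"
    using S.unit_arrow[OF \<Lambda>V] \<Lambda>_arrow_iff[OF V T.R.fobj_in_obj[OF M]] by (simp add: \<Lambda>_Rgt[OF M])
  define k where "k = Counit T ?M \<cdot>\<^bsub>A\<^esub> FMap (Lft T) V (FObj (Rgt T) ?M) (Unit S (FObj \<Lambda> V))"
  have k: "k \<in> ?N \<rightarrow>\<^bsub>A\<^esub> ?M" and Rk: "FMap R ?N ?M k \<cdot>\<^bsub>B\<^esub> Unit T V = Unit S (FObj \<Lambda> V)"
    unfolding k_def using T.transpose_arrow[OF u M] T.stage_cotranspose_transpose[OF u M] by simp_all
  note uT = T.unit_arrow[OF V] and uS = S.unit_arrow[OF \<Lambda>V]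
  have uB: "Unit T V \<in> base V \<rightarrow>\<^bsub>B\<^esub> FObj R ?N" "Unit S (FObj \<Lambda> V) \<in> base V \<rightarrow>\<^bsub>B\<^esub> FObj R ?M"
    using T.base_arrow[OF uT] S.base_arrow[OF uS] by (simp_all add: T.base_Rgt S.base_Rgt base_\<Lambda>[OF V])
  show thesis
  proof (rule that[OF k])
    show "k \<cdot>\<^bsub>A\<^esub> comp_iso V = Ident A ?M"
      by (rule S.stage_cotranspose_inject[OF \<Lambda>V T.base.L.D.cmp_arrow[OF l k] T.base.L.D.ident_arrow[OF M]])
        (use cmp_comparison_iso_unit[OF V k] Rk T.base.R.fmap_ident[OF M] T.base.L.C.ident_left[OF uB(2)] in simp)
    have "FMap R ?N ?N (comp_iso V \<cdot>\<^bsub>A\<^esub> k) \<cdot>\<^bsub>B\<^esub> Unit T V = FMap R ?M ?N (comp_iso V) \<cdot>\<^bsub>B\<^esub> Unit S (FObj \<Lambda> V)"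
      using T.base.R.fmap_comp[OF k l] Rk
        T.stage_assoc[OF uT T.stage_Rgt_arrow[OF k] T.stage_Rgt_arrow[OF l]] by simp
    then show "comp_iso V \<cdot>\<^bsub>A\<^esub> k = Ident A ?N"
      by (intro T.stage_cotranspose_inject[OF V T.base.L.D.cmp_arrow[OF k l] T.base.L.D.ident_arrow[OF N]])
        (simp add: comparison_iso_unit[OF V] T.base.R.fmap_ident[OF N] T.base.L.C.ident_left[OF uB(1)])
  qed
qed

lemma cancel_comparison_iso:
  assumes V: "V \<in> Obj (Cat T)" and x: "x \<in> FObj R (FObj (Lft T) V) \<rightarrow>\<^bsub>B\<^esub> Z" "y \<in> FObj R (FObj (Lft T) V) \<rightarrow>\<^bsub>B\<^esub> Z"
    and eq: "x \<cdot>\<^bsub>B\<^esub> FMap R (FObj (Lft S) (FObj \<Lambda> V)) (FObj (Lft T) V) (comp_iso V)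
      = y \<cdot>\<^bsub>B\<^esub> FMap R (FObj (Lft S) (FObj \<Lambda> V)) (FObj (Lft T) V) (comp_iso V)"
  shows "x = y"
proof -
  let ?M = "FObj (Lft S) (FObj \<Lambda> V)" and ?N = "FObj (Lft T) V"
  let ?l = "FMap R ?M ?N (comp_iso V)"
  obtain k where k: "k \<in> ?N \<rightarrow>\<^bsub>A\<^esub> ?M" "comp_iso V \<cdot>\<^bsub>A\<^esub> k = Ident A ?N"
    using comparison_iso_inverse[OF V] by metis
  note l = comparison_iso_arrow[OF V]
  have "?l \<cdot>\<^bsub>B\<^esub> FMap R ?N ?M k = Ident B (FObj R ?N)"
    using T.base.R.fmap_comp[OF k(1) l] k(2) T.base.R.fmap_ident[OF arrows_dom[OF k(1)]] by simp
  then have "z = (z \<cdot>\<^bsub>B\<^esub> ?l) \<cdot>\<^bsub>B\<^esub> FMap R ?N ?M k" if "z \<in> FObj R ?N \<rightarrow>\<^bsub>B\<^esub> Z" for z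
    using T.base.L.C.assoc[OF T.base.R.fmap_arrow[OF k(1)] T.base.R.fmap_arrow[OF l] that]
      T.base.L.C.ident_right[OF that] by simp
  then show ?thesis using x eq by metis
qed

text \<open>
  Both sides cotranspose to the identity.  This equation is what makes \<open>\<Lambda> \<circ> Rgt T = Rgt S\<close> pass to the next stage.
\<close>

lemma counit_comparison_iso:
  assumes Y: "Y \<in> Obj A"
  shows "Counit T Y \<cdot>\<^bsub>A\<^esub> comp_iso (FObj (Rgt T) Y) = Counit S Y"
proof -
  note V = T.R.fobj_in_obj[OF Y] and cT = T.counit_arrow[OF Y] and cS = S.counit_arrow[OF Y]
  have eq: "FObj \<Lambda> (FObj (Rgt T) Y) = FObj (Rgt S) Y" by (rule \<Lambda>_Rgt[OF Y])
  show ?thesis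
    by (rule S.stage_cotranspose_inject[OF S.R.fobj_in_obj[OF Y]
          T.base.L.D.cmp_arrow[OF comparison_iso_arrow[OF V, unfolded eq] cT] cS])
      (use cmp_comparison_iso_unit[OF V cT] T.stage_triangle[OF Y] S.stage_triangle[OF Y] in \<open>simp add: eq\<close>)
qed

text \<open>
  The structure arrow of \<open>\<Lambda>' (V, \<mu>)\<close> is \<open>\<mu> \<cdot> R (\<lambda> V)\<close>.  As \<open>\<lambda>\<close> is natural, the equations for an arrow \<open>f\<close> of \<open>T'\<close> and of \<open>S'\<close>
  differ by the factor \<open>R (\<lambda> V)\<close>, which can be cancelled; this gives full faithfulness, and
  cancelling in the structure arrows themselves gives injectivity.  For repleteness, an
  isomorphism \<open>\<Lambda>' (W, \<mu>) \<rightarrow> (V', b)\<close> is an isomorphism \<open>\<Lambda> W \<rightarrow> V'\<close>, so \<open>V' = \<Lambda> V\<close> by the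
  induction hypothesis, and \<open>b\<close> is determined by the isomorphism.
\<close>

lemma next_comparison_stage:
  fixes cq
  defines "T' \<equiv> next_stage A T (monadic_category T)
      (\<lambda>Y. FMap (Rgt T) (FObj (Lft T) (FObj (Rgt T) Y)) Y (Counit T Y)) (monadic_coeq cq T)"
    and "S' \<equiv> next_stage A S (adj_category B R S)
      (\<lambda>Y. FMap R (FObj (Lft S) (FObj (Rgt S) Y)) Y (Counit S Y)) (adj_coeq A cq L R \<epsilon> S)"
  assumes cq: "chosen_coequalizers A cq"
    and \<Lambda>': "\<And>X. FObj \<Lambda>' X = Ext (FObj \<Lambda> (under X)) (str X \<cdot>\<^bsub>B\<^esub>
      FMap R (FObj (Lft S) (FObj \<Lambda> (under X))) (FObj (Lft T) (under X)) (comp_iso (under X)))"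
    and FMap_\<Lambda>': "\<And>X Y f. FMap \<Lambda>' X Y f = f"
  shows "comparison_stage A B L R \<eta> \<epsilon> T' S' \<Lambda>'"
proof -
  note T_next = T.monadic_next[OF cq] and S_next = S.adj_next[OF cq]
  have Cat: "Cat T' = monadic_category T" "Cat S' = adj_category B R S"
    by (simp_all add: T'_def S'_def next_stage_def Let_def)
  interpret T': tower_stage A B L R \<eta> \<epsilon> T'
    unfolding T'_def by (rule next_tower_stage.tower_stage_next[OF T_next])
  interpret S': tower_stage A B L R \<eta> \<epsilon> S'
    unfolding S'_def by (rule next_tower_stage.tower_stage_next[OF S_next])
  note T_obj = next_tower_stage.next_obj[OF T_next, folded Cat]
    and S_obj = next_tower_stage.next_obj[OF S_next, folded Cat]
    and T_arrow = next_tower_stage.next_arrow_iff[OF T_next, folded Cat]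
    and S_arrow = next_tower_stage.next_arrow_iff[OF S_next, folded Cat]
  define l where "l V = FMap R (FObj (Lft S) (FObj \<Lambda> V)) (FObj (Lft T) V) (comp_iso V)" for V
  have \<Lambda>'_eq: "FObj \<Lambda>' X = Ext (FObj \<Lambda> (under X)) (str X \<cdot>\<^bsub>B\<^esub> l (under X))" for X
    by (simp add: \<Lambda>' l_def)
  have l: "l V \<in> FObj R (FObj (Lft S) (FObj \<Lambda> V)) \<rightarrow>\<^bsub>B\<^esub> FObj R (FObj (Lft T) V)" if "V \<in> Obj (Cat T)" for V
    unfolding l_def by (rule T.base.R.fmap_arrow[OF comparison_iso_arrow[OF that]])
  \<comment> \<open>\<open>R \<circ> Lft\<close> on arrows, for either stage.\<close>
  define FT where "FT V W f = FMap R (FObj (Lft T) V) (FObj (Lft T) W) (FMap (Lft T) V W f)" for V W f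
  define FS where "FS V W f = FMap R (FObj (Lft S) V) (FObj (Lft S) W) (FMap (Lft S) V W f)" for V W f
  have FT: "FT V W f \<in> FObj R (FObj (Lft T) V) \<rightarrow>\<^bsub>B\<^esub> FObj R (FObj (Lft T) W)" if "f \<in> V \<rightarrow>\<^bsub>Cat T\<^esub> W" for V W f
    unfolding FT_def by (rule T.base.R.fmap_arrow[OF T.L.fmap_arrow[OF that]])
  have FS: "FS V W f \<in> FObj R (FObj (Lft S) V) \<rightarrow>\<^bsub>B\<^esub> FObj R (FObj (Lft S) W)" if "f \<in> V \<rightarrow>\<^bsub>Cat S\<^esub> W" for V W f
    unfolding FS_def by (rule T.base.R.fmap_arrow[OF S.L.fmap_arrow[OF that]])
  have l_natural: "l W \<cdot>\<^bsub>B\<^esub> FS (FObj \<Lambda> V) (FObj \<Lambda> W) f = FT V W f \<cdot>\<^bsub>B\<^esub> l V" if f: "f \<in> V \<rightarrow>\<^bsub>Cat T\<^esub> W" for V W f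
    using comparison_iso_natural[OF f]
      T.base.R.fmap_comp[OF S.L.fmap_arrow[OF \<Lambda>_arrow[OF f]] comparison_iso_arrow[OF arrows_cod[OF f]]]
      T.base.R.fmap_comp[OF comparison_iso_arrow[OF arrows_dom[OF f]] T.L.fmap_arrow[OF f]]
    by (simp add: l_def FS_def FT_def)
  have \<Lambda>'_obj: "FObj \<Lambda>' X \<in> Obj (Cat S')" if X: "X \<in> Obj (Cat T')" for X
    using T.base.L.C.cmp_arrow[OF l[OF T_obj(2)[OF X]] T_obj(3)[OF X]] \<Lambda>_obj[OF T_obj(2)[OF X]]
      T_obj(4)[OF X] base_\<Lambda>[OF T_obj(2)[OF X]]
    by (simp add: \<Lambda>'_eq Cat adj_category_def arrows_iff)
  have arrow_iff: "f \<in> FObj \<Lambda>' X \<rightarrow>\<^bsub>Cat S'\<^esub> FObj \<Lambda>' Y \<longleftrightarrow> f \<in> X \<rightarrow>\<^bsub>Cat T'\<^esub> Y"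
    if X: "X \<in> Obj (Cat T')" and Y: "Y \<in> Obj (Cat T')" for X Y f
  proof (cases "f \<in> under X \<rightarrow>\<^bsub>Cat T\<^esub> under Y")
    case f: True
    let ?V = "under X" and ?W = "under Y"
    note V = T_obj(2)[OF X] and W = T_obj(2)[OF Y] and fB = T.base_arrow[OF f]
    note bX = T_obj(3)[OF X, unfolded T_obj(4)[OF X]] and bY = T_obj(3)[OF Y, unfolded T_obj(4)[OF Y]]
    have left: "f \<cdot>\<^bsub>B\<^esub> (str X \<cdot>\<^bsub>B\<^esub> l ?V) = (f \<cdot>\<^bsub>B\<^esub> str X) \<cdot>\<^bsub>B\<^esub> l ?V"
      using T.base.L.C.assoc[OF l[OF V] bX fB] by simp
    have right: "(str Y \<cdot>\<^bsub>B\<^esub> l ?W) \<cdot>\<^bsub>B\<^esub> FS (FObj \<Lambda> ?V) (FObj \<Lambda> ?W) f = (str Y \<cdot>\<^bsub>B\<^esub> FT ?V ?W f) \<cdot>\<^bsub>B\<^esub> l ?V"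
      using T.base.L.C.assoc[OF FS[OF \<Lambda>_arrow[OF f]] l[OF W] bY] l_natural[OF f]
        T.base.L.C.assoc[OF l[OF V] FT[OF f] bY] by simp
    have "f \<cdot>\<^bsub>B\<^esub> (str X \<cdot>\<^bsub>B\<^esub> l ?V) = (str Y \<cdot>\<^bsub>B\<^esub> l ?W) \<cdot>\<^bsub>B\<^esub> FS (FObj \<Lambda> ?V) (FObj \<Lambda> ?W) f
        \<longleftrightarrow> f \<cdot>\<^bsub>B\<^esub> str X = str Y \<cdot>\<^bsub>B\<^esub> FT ?V ?W f"
      unfolding left right
      by (rule iffI, rule cancel_comparison_iso[OF V T.base.L.C.cmp_arrow[OF bX fB]
            T.base.L.C.cmp_arrow[OF FT[OF f] bY], folded l_def]) simp_all
    then show ?thesis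
      using X Y \<Lambda>'_obj \<Lambda>_arrow[OF f] f
      by (simp add: S_arrow T_arrow) (simp add: \<Lambda>'_eq FS_def FT_def)
  next
    case False
    then show ?thesis
      using \<Lambda>_arrow_iff[OF T_obj(2)[OF X] T_obj(2)[OF Y]] by (simp add: S_arrow T_arrow \<Lambda>'_eq)
  qed
  show ?thesis
  proof
    show "FMap \<Lambda>' V W f = f" for V W f by (rule FMap_\<Lambda>')
    show "FObj \<Lambda>' X \<in> Obj (Cat S')" if "X \<in> Obj (Cat T')" for X by (rule \<Lambda>'_obj[OF that])
    show "base (FObj \<Lambda>' X) = base X" if "X \<in> Obj (Cat T')" for X
      using base_\<Lambda>[OF T_obj(2)[OF that]] T_obj(4)[OF that] by (simp add: \<Lambda>'_eq)
    show "Hom (Cat S') (FObj \<Lambda>' X) (FObj \<Lambda>' Y) = Hom (Cat T') X Y"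
      if "X \<in> Obj (Cat T')" "Y \<in> Obj (Cat T')" for X Y
      using arrow_iff[OF that] \<Lambda>'_obj that by (auto simp: arrows_iff)
    show "inj_on (FObj \<Lambda>') (Obj (Cat T'))"
    proof (rule inj_onI)
      fix X Y assume X: "X \<in> Obj (Cat T')" and Y: "Y \<in> Obj (Cat T')" and eq: "FObj \<Lambda>' X = FObj \<Lambda>' Y"
      have V: "under X = under Y"
        using eq inj_onD[OF inj_\<Lambda> _ T_obj(2)[OF X] T_obj(2)[OF Y]] by (simp add: \<Lambda>'_eq)
      moreover have "str X = str Y"
        by (rule cancel_comparison_iso[OF T_obj(2)[OF X] T_obj(3)[OF X], folded l_def])
          (use eq V T_obj(3,4)[OF Y] T_obj(4)[OF X] in \<open>simp_all add: \<Lambda>'_eq\<close>)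
      ultimately show "X = Y" using T_obj(1)[OF X] T_obj(1)[OF Y] by simp
    qed
    show "FObj \<Lambda>' (FObj (Rgt T') Y) = FObj (Rgt S') Y" if Y: "Y \<in> Obj A" for Y
      using counit_comparison_iso[OF Y] \<Lambda>_Rgt[OF Y]
        T.base.R.fmap_comp[OF comparison_iso_arrow[OF T.R.fobj_in_obj[OF Y]] T.counit_arrow[OF Y]]
      by (simp add: \<Lambda>'_eq T'_def S'_def next_stage_def Let_def T.FMap_Rgt l_def)
    show "X \<in> FObj \<Lambda>' ` Obj (Cat T')"
      if Y: "Y \<in> Obj (Cat T')" and f': "f \<in> FObj \<Lambda>' Y \<rightarrow>\<^bsub>Cat S'\<^esub> X" and g': "g \<in> X \<rightarrow>\<^bsub>Cat S'\<^esub> FObj \<Lambda>' Y"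
        and gf: "g \<cdot>\<^bsub>B\<^esub> f = Ident B (base Y)" and fg: "f \<cdot>\<^bsub>B\<^esub> g = Ident B (base X)" for X Y f g
    proof -
      let ?W = "under Y" and ?\<mu> = "str Y"
      have X: "X \<in> Obj (Cat S')" using f' by (rule arrows_cod)
      note W = T_obj(2)[OF Y]
      have fS: "f \<in> FObj \<Lambda> ?W \<rightarrow>\<^bsub>Cat S\<^esub> under X" and gS: "g \<in> under X \<rightarrow>\<^bsub>Cat S\<^esub> FObj \<Lambda> ?W"
        using f' g' by (simp_all add: S_arrow \<Lambda>'_eq)
      have "under X \<in> FObj \<Lambda> ` Obj (Cat T)"
        by (rule \<Lambda>_replete[OF W fS gS]) (use gf fg T_obj(4)[OF Y] S_obj(4)[OF X] in simp_all)
      then obtain V where V: "V \<in> Obj (Cat T)" and uX: "under X = FObj \<Lambda> V" by auto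
      have f: "f \<in> ?W \<rightarrow>\<^bsub>Cat T\<^esub> V" and g: "g \<in> V \<rightarrow>\<^bsub>Cat T\<^esub> ?W"
        using fS gS \<Lambda>_arrow_iff V W uX by simp_all
      have baseV: "base X = base V" using S_obj(4)[OF X] uX base_\<Lambda>[OF V] by simp
      \<comment> \<open>The algebra structure of \<open>Y\<close> transported along \<open>f\<close>.\<close>
      define \<nu> where "\<nu> = f \<cdot>\<^bsub>B\<^esub> (?\<mu> \<cdot>\<^bsub>B\<^esub> FT V ?W g)"
      have alg: "Ext ?W ?\<mu> \<in> Obj (monadic_category T)" using Y T_obj(1)[OF Y] by (simp add: Cat)
      have "Ext V \<nu> \<in> Obj (monadic_category T)"
        using T.algebra_transport[unfolded T.Cmp_Cat T.FMap_Rgt, of ?\<mu> ?W f V g \<nu>] alg f g gf fg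
        by (simp add: T.monadic_category_obj_iff Let_def T.Ident_Cat V W T_obj(4)[OF Y] baseV \<nu>_def FT_def)
      then have Z: "Ext V \<nu> \<in> Obj (Cat T')" by (simp add: Cat)
      have b: "str X \<in> FObj R (FObj (Lft S) (FObj \<Lambda> V)) \<rightarrow>\<^bsub>B\<^esub> base V"
        using S_obj(3)[OF X] uX baseV by simp
      have \<mu>: "?\<mu> \<in> FObj R (FObj (Lft T) ?W) \<rightarrow>\<^bsub>B\<^esub> base ?W" using T_obj(3,4)[OF Y] by simp
      note fB = T.base_arrow[OF f] and Sf = \<Lambda>_arrow[OF f] and Sg = \<Lambda>_arrow[OF g]
      \<comment> \<open>\<open>str X = str X \<cdot> FS f \<cdot> FS g = f \<cdot> \<mu> \<cdot> l \<cdot> FS g = f \<cdot> \<mu> \<cdot> FT g \<cdot> l = \<nu> \<cdot> l\<close>.\<close>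
      have "FS (FObj \<Lambda> ?W) (FObj \<Lambda> V) f \<cdot>\<^bsub>B\<^esub> FS (FObj \<Lambda> V) (FObj \<Lambda> ?W) g
          = FS (FObj \<Lambda> V) (FObj \<Lambda> V) (Ident (Cat S) (FObj \<Lambda> V))"
        using S.L.fmap_comp[OF Sg Sf] T.base.R.fmap_comp[OF S.L.fmap_arrow[OF Sg] S.L.fmap_arrow[OF Sf]]
          fg baseV by (simp add: FS_def S.Cmp_Cat S.Ident_Cat[OF \<Lambda>_obj[OF V]] base_\<Lambda>[OF V])
      also have "\<dots> = Ident B (FObj R (FObj (Lft S) (FObj \<Lambda> V)))"
        using S.L.fmap_ident[OF \<Lambda>_obj[OF V]] T.base.R.fmap_ident[OF S.L.fobj_in_obj[OF \<Lambda>_obj[OF V]]]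
        by (simp add: FS_def)
      finally have "str X = (str X \<cdot>\<^bsub>B\<^esub> FS (FObj \<Lambda> ?W) (FObj \<Lambda> V) f) \<cdot>\<^bsub>B\<^esub> FS (FObj \<Lambda> V) (FObj \<Lambda> ?W) g"
        using T.base.L.C.assoc[OF FS[OF Sg] FS[OF Sf] b] T.base.L.C.ident_right[OF b] by simp
      also have "str X \<cdot>\<^bsub>B\<^esub> FS (FObj \<Lambda> ?W) (FObj \<Lambda> V) f = f \<cdot>\<^bsub>B\<^esub> (?\<mu> \<cdot>\<^bsub>B\<^esub> l ?W)"
        using f' uX by (simp add: S_arrow \<Lambda>'_eq FS_def)
      also have "\<dots> \<cdot>\<^bsub>B\<^esub> FS (FObj \<Lambda> V) (FObj \<Lambda> ?W) g = f \<cdot>\<^bsub>B\<^esub> (?\<mu> \<cdot>\<^bsub>B\<^esub> (l ?W \<cdot>\<^bsub>B\<^esub> FS (FObj \<Lambda> V) (FObj \<Lambda> ?W) g))"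
        using T.base.L.C.assoc[OF FS[OF Sg] T.base.L.C.cmp_arrow[OF l[OF W] \<mu>] fB]
          T.base.L.C.assoc[OF FS[OF Sg] l[OF W] \<mu>] by simp
      also have "\<dots> = \<nu> \<cdot>\<^bsub>B\<^esub> l V"
        unfolding l_natural[OF g] \<nu>_def
        using T.base.L.C.assoc[OF l[OF V] FT[OF g] \<mu>]
          T.base.L.C.assoc[OF l[OF V] T.base.L.C.cmp_arrow[OF FT[OF g] \<mu>] fB] by simp
      finally have "str X = \<nu> \<cdot>\<^bsub>B\<^esub> l V" .
      then have "X = FObj \<Lambda>' (Ext V \<nu>)" using S_obj(1)[OF X] uX by (simp add: \<Lambda>'_eq)
      then show ?thesis using Z by blast
    qed
  qed
qed

end

section \<open>Consequences of full faithfulness\<close>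

context comparison_stage
begin

text \<open>
  On arrows \<open>V \<rightarrow> W\<close>, \<open>Lft T\<close> is \<open>Lft S\<close> conjugated by the invertible components of \<open>\<lambda>\<close>.
\<close>

lemma fully_faithful_Lft:
  assumes ff: "fully_faithful (Cat S) A (Lft S)"
  shows "fully_faithful (Cat T) A (Lft T)"
proof
  interpret S': fully_faithful "Cat S" A "Lft S" by (rule ff)
  fix V W assume V: "V \<in> Obj (Cat T)" and W: "W \<in> Obj (Cat T)"
  let ?F = "FMap (Lft S) (FObj \<Lambda> V) (FObj \<Lambda> W)"
  have bij: "bij_betw ?F (Hom (Cat T) V W) (Hom A (FObj (Lft S) (FObj \<Lambda> V)) (FObj (Lft S) (FObj \<Lambda> W)))"
    using S'.fmap_bij[OF \<Lambda>_obj[OF V] \<Lambda>_obj[OF W]] by (simp add: Hom_\<Lambda>[OF V W])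
  obtain j where j: "j \<in> FObj (Lft T) V \<rightarrow>\<^bsub>A\<^esub> FObj (Lft S) (FObj \<Lambda> V)"
    "comp_iso V \<cdot>\<^bsub>A\<^esub> j = Ident A (FObj (Lft T) V)"
    using comparison_iso_inverse[OF V] by metis
  obtain k where k: "k \<in> FObj (Lft T) W \<rightarrow>\<^bsub>A\<^esub> FObj (Lft S) (FObj \<Lambda> W)"
    "k \<cdot>\<^bsub>A\<^esub> comp_iso W = Ident A (FObj (Lft S) (FObj \<Lambda> W))"
    "comp_iso W \<cdot>\<^bsub>A\<^esub> k = Ident A (FObj (Lft T) W)"
    using comparison_iso_inverse[OF W] by metis
  note lV = comparison_iso_arrow[OF V] and lW = comparison_iso_arrow[OF W]
  have hom: "f \<in> V \<rightarrow>\<^bsub>Cat T\<^esub> W \<longleftrightarrow> f \<in> Hom (Cat T) V W" for f using V W by (simp add: arrows_iff)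
  show "bij_betw (FMap (Lft T) V W) (Hom (Cat T) V W) (Hom A (FObj (Lft T) V) (FObj (Lft T) W))"
    unfolding bij_betw_def
  proof
    have F: "?F f = k \<cdot>\<^bsub>A\<^esub> (FMap (Lft T) V W f \<cdot>\<^bsub>A\<^esub> comp_iso V)" if f: "f \<in> V \<rightarrow>\<^bsub>Cat T\<^esub> W" for f
      using comparison_iso_natural[OF f] k(2) T.base.L.D.ident_left[OF S.L.fmap_arrow[OF \<Lambda>_arrow[OF f]]]
        T.base.L.D.assoc[OF S.L.fmap_arrow[OF \<Lambda>_arrow[OF f]] lW k(1)] by simp
    show "inj_on (FMap (Lft T) V W) (Hom (Cat T) V W)"
    proof (rule inj_onI)
      fix f g assume "f \<in> Hom (Cat T) V W" "g \<in> Hom (Cat T) V W" "FMap (Lft T) V W f = FMap (Lft T) V W g"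
      then show "f = g" using F hom bij by (metis bij_betw_def inj_onD)
    qed
    show "FMap (Lft T) V W ` Hom (Cat T) V W = Hom A (FObj (Lft T) V) (FObj (Lft T) W)"
    proof
      show "FMap (Lft T) V W ` Hom (Cat T) V W \<subseteq> Hom A (FObj (Lft T) V) (FObj (Lft T) W)"
        using T.L.fmap_in_hom[OF V W] by auto
      show "Hom A (FObj (Lft T) V) (FObj (Lft T) W) \<subseteq> FMap (Lft T) V W ` Hom (Cat T) V W"
      proof
        fix h assume "h \<in> Hom A (FObj (Lft T) V) (FObj (Lft T) W)"
        then have h: "h \<in> FObj (Lft T) V \<rightarrow>\<^bsub>A\<^esub> FObj (Lft T) W"
          using T.L.fobj_in_obj V W by (simp add: arrows_iff)
        note hl = T.base.L.D.cmp_arrow[OF lV h]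
        have "k \<cdot>\<^bsub>A\<^esub> (h \<cdot>\<^bsub>A\<^esub> comp_iso V) \<in> ?F ` Hom (Cat T) V W"
          using bij T.base.L.D.cmp_arrow[OF hl k(1)] by (auto simp: bij_betw_def arrows_iff)
        then obtain f where f: "f \<in> V \<rightarrow>\<^bsub>Cat T\<^esub> W" and Ff: "?F f = k \<cdot>\<^bsub>A\<^esub> (h \<cdot>\<^bsub>A\<^esub> comp_iso V)"
          using hom by auto
        have "FMap (Lft T) V W f \<cdot>\<^bsub>A\<^esub> comp_iso V = h \<cdot>\<^bsub>A\<^esub> comp_iso V"
          using comparison_iso_natural[OF f] Ff T.base.L.D.assoc[OF hl k(1) lW] k(3)
            T.base.L.D.ident_left[OF hl] by simp
        then have "(FMap (Lft T) V W f \<cdot>\<^bsub>A\<^esub> comp_iso V) \<cdot>\<^bsub>A\<^esub> j = (h \<cdot>\<^bsub>A\<^esub> comp_iso V) \<cdot>\<^bsub>A\<^esub> j" by simp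
        then have "FMap (Lft T) V W f = h"
          using T.base.L.D.assoc[OF j(1) lV h] T.base.L.D.assoc[OF j(1) lV T.L.fmap_arrow[OF f]] j(2)
            T.base.L.D.ident_right[OF h] T.base.L.D.ident_right[OF T.L.fmap_arrow[OF f]] by simp
        then show "h \<in> FMap (Lft T) V W ` Hom (Cat T) V W" using f hom by blast
      qed
    qed
  qed
qed

text \<open>
  The unit of \<open>S\<close> at \<open>X\<close> is an isomorphism from \<open>X\<close> to \<open>\<Lambda> (Rgt T (Lft S X))\<close>, an object of the image.
\<close>

lemma surj_\<Lambda>:
  assumes ff: "fully_faithful (Cat S) A (Lft S)"
  shows "FObj \<Lambda> ` Obj (Cat T) = Obj (Cat S)"
proof
  show "FObj \<Lambda> ` Obj (Cat T) \<subseteq> Obj (Cat S)" using \<Lambda>_obj by auto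
  show "Obj (Cat S) \<subseteq> FObj \<Lambda> ` Obj (Cat T)"
  proof
    fix X assume X: "X \<in> Obj (Cat S)"
    let ?M = "FObj (Lft S) X"
    have M: "?M \<in> Obj A" by (rule S.L.fobj_in_obj[OF X])
    obtain e where e: "e \<in> FObj (Rgt S) ?M \<rightarrow>\<^bsub>Cat S\<^esub> X" "e \<cdot>\<^bsub>B\<^esub> Unit S X = Ident B (base X)"
      "Unit S X \<cdot>\<^bsub>B\<^esub> e = Ident B (FObj R ?M)"
      using S.unit_iso_if_fully_faithful[OF ff X]
      by (auto simp: S.Cmp_Cat S.Ident_Cat X S.R.fobj_in_obj M S.base_Rgt)
    show "X \<in> FObj \<Lambda> ` Obj (Cat T)"
      by (rule \<Lambda>_replete[OF T.R.fobj_in_obj[OF M], of e X "Unit S X"])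
        (use e S.unit_arrow[OF X] in \<open>simp_all add: \<Lambda>_Rgt[OF M] T.base_Rgt\<close>)
  qed
qed

lemma category_isomorphism_\<Lambda>:
  assumes surj: "FObj \<Lambda> ` Obj (Cat T) = Obj (Cat S)"
  shows "category_isomorphism (Cat T) (Cat S) \<Lambda>"
proof -
  define G :: "(('o, 'm) tower_obj, 'm, ('o, 'm) tower_obj, 'm) functor_data"
    where "G = \<lparr>FObj = inv_into (Obj (Cat T)) (FObj \<Lambda>), FMap = (\<lambda>X Y f. f)\<rparr>"
  have FMap_G: "FMap G X Y f = f" for X Y f by (simp add: G_def)
  have G_obj: "FObj G X \<in> Obj (Cat T)" "FObj \<Lambda> (FObj G X) = X" if "X \<in> Obj (Cat S)" for X
    using that surj by (auto simp: G_def inv_into_into f_inv_into_f)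
  have G_\<Lambda>: "FObj G (FObj \<Lambda> V) = V" if "V \<in> Obj (Cat T)" for V
    using that inj_\<Lambda> by (simp add: G_def)
  have "cat_functor (Cat T) (Cat S) \<Lambda>"
    by unfold_locales
      (simp_all add: FMap_\<Lambda> \<Lambda>_obj Hom_\<Lambda> base_\<Lambda> T.Cmp_Cat S.Cmp_Cat T.Ident_Cat S.Ident_Cat)
  moreover have "cat_functor (Cat S) (Cat T) G"
  proof
    fix X Y f assume X: "X \<in> Obj (Cat S)" and Y: "Y \<in> Obj (Cat S)" and "f \<in> Hom (Cat S) X Y"
    then show "FMap G X Y f \<in> Hom (Cat T) (FObj G X) (FObj G Y)"
      using Hom_\<Lambda>[OF G_obj(1)[OF X] G_obj(1)[OF Y]] by (simp add: G_obj FMap_G)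
  next
    fix X assume X: "X \<in> Obj (Cat S)"
    show "FMap G X X (Ident (Cat S) X) = Ident (Cat T) (FObj G X)"
      using base_\<Lambda>[OF G_obj(1)[OF X]] G_obj[OF X] X
      by (simp add: T.Ident_Cat S.Ident_Cat FMap_G)
  qed (simp_all add: G_obj FMap_G T.Cmp_Cat S.Cmp_Cat)
  ultimately show ?thesis
    unfolding category_isomorphism_def functor_eq_on_def
    by (intro conjI exI[of _ G])
      (simp_all add: comp_functor_def id_functor_def G_\<Lambda> G_obj FMap_\<Lambda> FMap_G)
qed

end

section \<open>Comparison of the two towers\<close>

lemma comparison_stage_initial:
  assumes "tower_stage A B L R \<eta> \<epsilon> S"
  shows "comparison_stage A B L R \<eta> \<epsilon> S S id_functor"
proof -
  interpret tower_stage A B L R \<eta> \<epsilon> S by fact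
  show ?thesis
    by unfold_locales (auto simp: id_functor_def arrows_iff)
qed

lemma comparison_stage_towers:
  assumes "adjunction A B L R \<eta> \<epsilon>" "chosen_coequalizers A cq"
  shows "comparison_stage A B L R \<eta> \<epsilon> (monadic_tower A cq B L R \<eta> \<epsilon> n)
    (adj_decomposition A cq B L R \<eta> \<epsilon> n) (comparison A cq B L R \<eta> \<epsilon> n)"
proof (induction n)
  case 0
  then show ?case using comparison_stage_initial[OF tower_stage_initial[OF assms(1)]] by simp
next
  case (Suc n)
  then interpret comparison_stage A B L R \<eta> \<epsilon> "monadic_tower A cq B L R \<eta> \<epsilon> n"
    "adj_decomposition A cq B L R \<eta> \<epsilon> n" "comparison A cq B L R \<eta> \<epsilon> n" .
  show ?case
    using next_comparison_stage[OF assms(2), of "comparison A cq B L R \<eta> \<epsilon> (Suc n)"]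
    by (simp add: Let_def FMap_\<Lambda>)
qed

theorem corollary4p21:
  fixes A :: "('p, 'n) category_data" and B :: "('o, 'm) category_data"
    and L :: "('o, 'm, 'p, 'n) functor_data" and R :: "('p, 'n, 'o, 'm) functor_data"
    and \<eta> :: "'o \<Rightarrow> 'm" and \<epsilon> :: "'p \<Rightarrow> 'n"
    and cq :: "('p, 'n) coeq_choice" and n :: nat
  assumes "adjunction A B L R \<eta> \<epsilon>"
    and "chosen_coequalizers A cq"
    and "fully_faithful (Cat (adj_decomposition A cq B L R \<eta> \<epsilon> n)) A
           (Lft (adj_decomposition A cq B L R \<eta> \<epsilon> n))"
  shows "fully_faithful (Cat (monadic_tower A cq B L R \<eta> \<epsilon> n)) A
           (Lft (monadic_tower A cq B L R \<eta> \<epsilon> n)) \<and>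
         category_isomorphism (Cat (monadic_tower A cq B L R \<eta> \<epsilon> n))
           (Cat (adj_decomposition A cq B L R \<eta> \<epsilon> n)) (comparison A cq B L R \<eta> \<epsilon> n) \<and>
         (\<exists>N\<le>n. has_monadic_decomposition_of_length A cq B L R \<eta> \<epsilon> N)"
proof -
  interpret comparison_stage A B L R \<eta> \<epsilon> "monadic_tower A cq B L R \<eta> \<epsilon> n"
    "adj_decomposition A cq B L R \<eta> \<epsilon> n" "comparison A cq B L R \<eta> \<epsilon> n"
    using comparison_stage_towers assms by blast
  let ?ff = "\<lambda>k. fully_faithful (Cat (monadic_tower A cq B L R \<eta> \<epsilon> k)) A (Lft (monadic_tower A cq B L R \<eta> \<epsilon> k))"
  have ff: "?ff n" by (rule fully_faithful_Lft[OF assms(3)])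
  have "has_monadic_decomposition_of_length A cq B L R \<eta> \<epsilon> (LEAST k. ?ff k)"
    unfolding has_monadic_decomposition_of_length_def Let_def using LeastI[of ?ff, OF ff] not_less_Least by blast
  then show ?thesis
    using ff category_isomorphism_\<Lambda>[OF surj_\<Lambda>[OF assms(3)]] Least_le[of ?ff, OF ff] by blast
qed

end
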